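(* Let $p$ be a positive integer and let $r$ be a nonnegative integer. Given any $2^p$-recognizable set $Y\subseteq\mathbb{N}$ (via a finite automaton $\mathcal{A}$ recognizing it), it is decidable whether $Y=m\mathcal{T}+r$ for some $m\in\mathbb{N}$ (where $m\ge 1$ and $r\in\{0,\ldots,m-1\}$). The decision procedure can be run in time $O(N^2)$, where $N$ is the number of states of the given automaton $\mathcal{A}$.
   Context: $A_{2^p}=\{0,\ldots,2^p-1\}$. For $w=c_\ell\cdots c_0\in A_{2^p}^*$, $\mathrm{val}_{2^p}(w)=\sum_j c_j2^{pj}$ (most significant digit first), and for $Y\subseteq\mathbb{N}$, $\mathrm{val}_{2^p}^{-1}(Y)=\{w\in A_{2^p}^*\colon\mathrm{val}_{2^p}(w)\in Y\}$. The set $Y$ is $2^p$-recognizable if this language is regular; a finite automaton recognizes $Y$ if it accepts the language $\mathrm{val}_{2^p}^{-1}(Y)$. $\mathcal{T}$ is the set of $n\in\mathbb{N}$ whose binary expansion has an even number of digits $1$; $m\mathcal{T}+r=\{mt+r\colon t\in\mathcal{T}\}$. *)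

theory Defs
  imports Complex_Main "HOL-Library.Landau_Symbols"
begin

section \<open>The Thue-Morse set and integer bases\<close>

definition thue_morse :: "nat set" where
  "thue_morse = {n. even (card {i. bit n i})}"

definition mult_trans :: "nat \<Rightarrow> nat \<Rightarrow> nat set \<Rightarrow> nat set" where
  "mult_trans m r X = (\<lambda>t. m * t + r) ` X"

text \<open>Words are lists of digits, most significant digit first.\<close>

definition val :: "nat \<Rightarrow> nat list \<Rightarrow> nat" where
  "val b w = (\<Sum>j<length w. rev w ! j * b ^ j)"

text \<open>All representations are included, also those with leading zeros and the empty word.\<close>

definition rep_lang :: "nat \<Rightarrow> nat set \<Rightarrow> nat list set" where
  "rep_lang b Y = {w \<in> lists {..<b}. val b w \<in> Y}"


section \<open>Deterministic finite automata over the alphabet \<open>{..<b}\<close>\<close>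

text \<open>
  The states are \<open>0, \<dots>, num_states A - 1\<close>, so that an automaton is a finite object that can be
  given to a machine. The transition function may be partial; complete automata are the special
  case where it never returns \<^const>\<open>None\<close> on a state and a letter.
\<close>

record dfa =
  num_states :: nat
  initial :: nat
  final :: "nat set"
  delta :: "nat \<Rightarrow> nat \<Rightarrow> nat option"

definition wf_dfa :: "nat \<Rightarrow> dfa \<Rightarrow> bool" where
  "wf_dfa b A \<longleftrightarrow>
     initial A < num_states A \<and>
     final A \<subseteq> {..<num_states A} \<and>
     (\<forall>q<num_states A. \<forall>a<b. \<forall>q'. delta A q a = Some q' \<longrightarrow> q' < num_states A)"

fun run :: "dfa \<Rightarrow> nat \<Rightarrow> nat list \<Rightarrow> nat option" where
  "run A q [] = Some q"
| "run A q (a # w) = (case delta A q a of None \<Rightarrow> None | Some q' \<Rightarrow> run A q' w)"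

definition language :: "nat \<Rightarrow> dfa \<Rightarrow> nat list set" where
  "language b A = {w \<in> lists {..<b}. \<exists>q\<in>final A. run A (initial A) w = Some q}"

definition recognizes :: "nat \<Rightarrow> dfa \<Rightarrow> nat set \<Rightarrow> bool" where
  "recognizes b A Y \<longleftrightarrow> wf_dfa b A \<and> language b A = rep_lang b Y"


section \<open>Random access machines with unit cost\<close>

text \<open>
  Structured programs for a random access machine with addition and (truncated) subtraction,
  but no multiplication, as unit-cost arithmetic operations. A program mentions finitely many
  registers; the memory is accessed by indirect addressing only. Replacing conditionals and loops
  by jumps changes the running time by a constant factor only.
\<close>

datatype com =
    Skip
  | Const nat nat
  | Add nat nat nat
  | Sub nat nat nat
  | Load nat nat
  | Store nat nat
  | Seq com com
  | If_nz nat com com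
  | While_nz nat com

record state =
  reg :: "nat \<Rightarrow> nat"
  mem :: "nat \<Rightarrow> nat"

text \<open>
  \<open>exec c s t s'\<close>: started in \<open>s\<close>, the program \<open>c\<close> terminates in \<open>s'\<close> after \<open>t\<close> steps.
  Every instruction and every test of a conditional or loop counts as one step.
\<close>

inductive exec :: "com \<Rightarrow> state \<Rightarrow> nat \<Rightarrow> state \<Rightarrow> bool" where
  Skip: "exec Skip s 1 s"
| Const: "exec (Const i n) s 1 (s\<lparr>reg := (reg s)(i := n)\<rparr>)"
| Add: "exec (Add i j k) s 1 (s\<lparr>reg := (reg s)(i := reg s j + reg s k)\<rparr>)"
| Sub: "exec (Sub i j k) s 1 (s\<lparr>reg := (reg s)(i := reg s j - reg s k)\<rparr>)"
| Load: "exec (Load i j) s 1 (s\<lparr>reg := (reg s)(i := mem s (reg s j))\<rparr>)"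
| Store: "exec (Store i j) s 1 (s\<lparr>mem := (mem s)(reg s i := reg s j)\<rparr>)"
| Seq: "exec c s t s' \<Longrightarrow> exec d s' t' s'' \<Longrightarrow> exec (Seq c d) s (t + t') s''"
| If_True: "reg s i \<noteq> 0 \<Longrightarrow> exec c s t s' \<Longrightarrow> exec (If_nz i c d) s (1 + t) s'"
| If_False: "reg s i = 0 \<Longrightarrow> exec d s t s' \<Longrightarrow> exec (If_nz i c d) s (1 + t) s'"
| While_True: "reg s i \<noteq> 0 \<Longrightarrow> exec c s t s' \<Longrightarrow> exec (While_nz i c) s' t' s'' \<Longrightarrow>
    exec (While_nz i c) s (1 + t + t') s''"
| While_False: "reg s i = 0 \<Longrightarrow> exec (While_nz i c) s 1 s"

inductive_cases exec_elims:
  "exec Skip s t s'" "exec (Const i n) s t s'" "exec (Add i j k) s t s'" "exec (Sub i j k) s t s'"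
  "exec (Load i j) s t s'" "exec (Store i j) s t s'"

inductive_cases exec_SeqE: "exec (Seq c d) s t s'"
inductive_cases exec_IfE: "exec (If_nz i c d) s t s'"
inductive_cases exec_WhileE: "exec (While_nz i c) s t s'"

text \<open>Programs are deterministic, so that one terminating execution is the only one.\<close>

lemma exec_deterministic:
  "exec c s t s' \<Longrightarrow> exec c s u s'' \<Longrightarrow> t = u \<and> s' = s''"
proof (induction arbitrary: u s'' rule: exec.induct)
  case (Seq c s t s' d t' s3)
  obtain t1 s1 t2 where *: "exec c s t1 s1" "exec d s1 t2 s''" "u = t1 + t2"
    using Seq.prems by (rule exec_SeqE)
  have "t = t1" "s' = s1" using Seq.IH(1)[OF *(1)] by simp_all
  then show ?case using Seq.IH(2)[of t2 s''] * by simp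
next
  case (If_True s i c t s' d)
  obtain t1 where "u = Suc t1" "exec c s t1 s''"
    using If_True.prems by (rule exec_IfE) (use If_True.hyps(1) in simp_all)
  then show ?case using If_True.IH[of t1 s''] by simp
next
  case (If_False s i d t s' c)
  obtain t1 where "u = Suc t1" "exec d s t1 s''"
    using If_False.prems by (rule exec_IfE) (use If_False.hyps(1) in simp_all)
  then show ?case using If_False.IH[of t1 s''] by simp
next
  case (While_True s i c t s' t' s3)
  obtain t1 s1 t2 where *: "exec c s t1 s1" "exec (While_nz i c) s1 t2 s''" "u = Suc (t1 + t2)"
    using While_True.prems by (rule exec_WhileE) (use While_True.hyps(1) in simp_all)
  have "t = t1" "s' = s1" using While_True.IH(1)[OF *(1)] by simp_all
  then show ?case using While_True.IH(2)[of t2 s''] * by simp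
next
  case (While_False s i c)
  show ?case using While_False.prems by (rule exec_WhileE) (use While_False.hyps in simp_all)
qed (erule exec_elims, simp)+

definition load_input :: "nat list \<Rightarrow> state" where
  "load_input xs = \<lparr>reg = (\<lambda>_. 0), mem = (\<lambda>i. if i < length xs then xs ! i else 0)\<rparr>"

text \<open>
  An automaton is given by its number of states, its initial state, one flag per state for
  finality, and its transition table, row by row. An undefined transition is represented by the
  number of states, which is not the number of a state.
\<close>

definition encode_dfa :: "nat \<Rightarrow> dfa \<Rightarrow> nat list" where
  "encode_dfa b A =
     [num_states A, initial A]
     @ map (\<lambda>q. if q \<in> final A then 1 else 0) [0..<num_states A]
     @ concat (map (\<lambda>q. map (\<lambda>a. case delta A q a of None \<Rightarrow> num_states A | Some q' \<Rightarrow> q') [0..<b])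
         [0..<num_states A])"

end

theory Submission
  imports Defs "HOL-Number_Theory.Cong"
begin

text \<open>
  Write \<open>b = 2 ^ p\<close> and \<open>m = k * 2 ^ z\<close> with \<open>k\<close> odd. Then \<open>v\<close> lies in \<open>m T + r\<close> iff
  \<open>v \<equiv> r (mod 2 ^ z)\<close>, \<open>v div 2 ^ z \<equiv> r div 2 ^ z (mod k)\<close>, and \<open>(v div 2 ^ z) div k\<close> has an even
  number of digits 1. If an automaton with \<open>n\<close> states recognizes \<open>m T + r\<close>, then the state reached
  by a word of value \<open>v\<close> determines \<open>v mod k\<close> and the parity of the number of digits 1 of
  \<open>v div k\<close>, because every number has extensions in \<open>m T + r\<close>; hence \<open>k \<le> n\<close>. Conversely, for
  given \<open>k\<close> and \<open>z \<le> p\<close>, one search through the automaton, in time \<open>O(n)\<close>, labels each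
  reachable state with such a pair, and fails on a state with two labels or with a wrong final flag
  behind an edge; the label is updated bit by bit by \<open>s \<mapsto> 2 * s + c\<close>, where subtracting \<open>k\<close>
  flips the parity.

  Large powers of 2 are removed first: since \<open>r\<close> and \<open>3 * m + r\<close> belong to \<open>m T + r\<close>, \<open>b\<close>
  divides \<open>m\<close> iff all elements end in the same digit, which is again tested by one search; this last
  digit is then dropped by changing the final states. Once \<open>r\<close> has become 0, this
  happens fewer than \<open>n\<close> times: if \<open>m = b ^ n * m'\<close> and \<open>u\<close> represents \<open>3 * m'\<close>, then two of the
  words \<open>u 0 ^ i\<close> with \<open>i \<le> n\<close> would reach the same state, but the first accepted word of this
  form is \<open>u 0 ^ n\<close>. So \<open>O(n)\<close> searches suffice.
\<close>

section \<open>Thue-Morse parity and residues\<close>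

text \<open>The parity is a number 0 or 1 because it later becomes the content of a register;
  \<open>1 - x\<close> flips it.\<close>

definition tp :: "nat \<Rightarrow> nat" where
  "tp v = card {i. bit v i} mod 2"

lemma thue_morse_iff: "v \<in> thue_morse \<longleftrightarrow> tp v = 0"
  by (auto simp: thue_morse_def tp_def even_iff_mod_2_eq_zero)

lemma tp_le_1: "tp v \<le> 1"
  by (simp add: tp_def)

lemma finite_bits: "finite {i. bit (v :: nat) i}"
proof (rule finite_subset)
  show "{i. bit v i} \<subseteq> {..<v}"
  proof
    fix i assume "i \<in> {i. bit v i}"
    then have "v div 2 ^ i \<noteq> 0" by (auto simp: bit_iff_odd intro: ccontr)
    then have "2 ^ i \<le> v" by (simp add: div_eq_0_iff)
    then show "i \<in> {..<v}" using less_exp[of i] by (metis less_le_trans lessThan_iff)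
  qed
qed simp

lemma tp_double: "tp (2 * v) = tp v"
proof -
  have "{i. bit (2 * v) i} = Suc ` {i. bit v i}"
    by (auto simp: image_iff bit_double_iff) (metis Suc_pred)
  then show ?thesis by (simp add: tp_def card_image)
qed

lemma tp_double_Suc: "tp (Suc (2 * v)) = 1 - tp v"
proof -
  have "{i. bit (Suc (2 * v)) i} = insert 0 (Suc ` {i. bit v i})"
  proof (rule set_eqI)
    fix i show "i \<in> {i. bit (Suc (2 * v)) i} \<longleftrightarrow> i \<in> insert 0 (Suc ` {i. bit v i})"
      by (cases i) (auto simp: bit_Suc bit_0)
  qed
  then have "card {i. bit (Suc (2 * v)) i} = Suc (card {i. bit v i})"
    by (simp add: finite_bits card_image)
  then show ?thesis by (simp add: tp_def) presburger
qed

lemma tp_0 [simp]: "tp 0 = 0" by (simp add: tp_def)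

text \<open>The binary digits of 3 are 11. The odd element 3 next to the element 0 yields the member
  \<open>3 * m + r\<close>, and its oddness rules out even cofactors later.\<close>

lemma tp_3: "tp 3 = 0"
  using tp_double_Suc[of 0] tp_double_Suc[of 1] by (simp add: numeral_eq_Suc)

text \<open>\<open>h\<close> fits into the \<open>j\<close> low positions, so the digits of both
  numbers stand side by side without carries and the counts add.\<close>

lemma tp_append: "h < 2 ^ j \<Longrightarrow> tp (2 ^ j * u + h) = (tp u + tp h) mod 2"
proof (induction j arbitrary: h)
  case 0
  then show ?case using tp_le_1[of u] by simp
next
  case (Suc j)
  define g where "g = h div 2"
  have g: "g < 2 ^ j" using Suc.prems by (simp add: g_def)
  note IH = Suc.IH[OF g]
  consider "h = 2 * g" | "h = Suc (2 * g)" unfolding g_def by linarith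
  then show ?case
  proof cases
    case 1
    then have "2 ^ Suc j * u + h = 2 * (2 ^ j * u + g)" by simp
    then show ?thesis using IH 1 by (simp only: tp_double)
  next
    case 2
    then have "2 ^ Suc j * u + h = Suc (2 * (2 ^ j * u + g))" by simp
    moreover have "1 - (tp u + tp g) mod 2 = (tp u + (1 - tp g)) mod 2"
      using tp_le_1[of u] tp_le_1[of g] by (auto simp: le_Suc_eq)
    ultimately show ?thesis using IH 2 by (simp only: tp_double_Suc)
  qed
qed

section \<open>Labels and their update by single bits\<close>

definition bitstep :: "nat \<Rightarrow> nat \<Rightarrow> nat \<times> nat \<Rightarrow> nat \<times> nat" where
  "bitstep k c v =
     (if 2 * fst v + c < k then (2 * fst v + c, snd v) else (2 * fst v + c - k, 1 - snd v))"

text \<open>The bits of \<open>h\<close> are fed from the most significant one: the recursion takes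
  off the last bit, which is applied last. The count \<open>j\<close> keeps leading zeros, which may
  change the label.\<close>

fun bitsteps :: "nat \<Rightarrow> nat \<Rightarrow> nat \<Rightarrow> nat \<times> nat \<Rightarrow> nat \<times> nat" where
  "bitsteps k 0 h v = v"
| "bitsteps k (Suc j) h v = bitstep k (h mod 2) (bitsteps k j (h div 2) v)"

definition residue :: "nat \<Rightarrow> nat \<Rightarrow> nat \<times> nat" where
  "residue k v = (v mod k, tp (v div k))"

text \<open>Appending a bit turns the quotient \<open>x\<close> by \<open>k\<close> into
  \<open>2 * x\<close> or \<open>2 * x + 1\<close>; the parity changes in the second case
  only.\<close>

lemma bitstep_residue:
  assumes "k > 0" "c < 2"
  shows "bitstep k c (residue k v) = residue k (2 * v + c)"
proof -
  define x s where "x = v div k" and "s = v mod k"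
  have v: "v = k * x + s" by (simp add: x_def s_def)
  have s: "s < k" using assms by (simp add: s_def)
  show ?thesis
  proof (cases "2 * s + c < k")
    case True
    have e: "2 * v + c = k * (2 * x) + (2 * s + c)" by (simp add: v)
    have "(2 * v + c) mod k = 2 * s + c" unfolding e using True by simp
    moreover have "(2 * v + c) div k = 2 * x" unfolding e using True assms by simp
    ultimately show ?thesis using True
      by (simp add: residue_def bitstep_def tp_double flip: x_def s_def)
  next
    case False
    have e: "2 * v + c = (2 * s + c - k) + k * Suc (2 * x)" using False by (simp add: v)
    have lt: "2 * s + c - k < k" using s assms by linarith
    have "(2 * v + c) mod k = 2 * s + c - k" unfolding e using lt by (simp only: mod_mult_self2 mod_less)
    moreover have "(2 * v + c) div k = Suc (2 * x)" unfolding e using lt assms by (simp only: div_mult_self2 div_less)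
    ultimately show ?thesis using False
      by (simp add: residue_def bitstep_def tp_double_Suc flip: x_def s_def)
  qed
qed

lemma bitsteps_residue:
  assumes "k > 0" "h < 2 ^ j"
  shows "bitsteps k j h (residue k v) = residue k (2 ^ j * v + h)"
  using assms(2)
proof (induction j arbitrary: h)
  case (Suc j)
  have "h div 2 < 2 ^ j" using Suc.prems by simp
  moreover have "2 * (2 ^ j * v + h div 2) + h mod 2 = 2 ^ Suc j * v + h" by simp
  moreover have "h mod 2 < 2" by simp
  ultimately show ?case using Suc.IH bitstep_residue[OF assms(1)] by (metis bitsteps.simps(2))
qed simp

section \<open>Membership through division with remainder\<close>

lemma mem_mult_trans_iff:
  assumes "r < m"
  shows "v \<in> mult_trans m r thue_morse \<longleftrightarrow> v mod m = r \<and> tp (v div m) = 0"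
proof
  assume "v \<in> mult_trans m r thue_morse"
  then show "v mod m = r \<and> tp (v div m) = 0"
    using assms by (auto simp: mult_trans_def thue_morse_iff)
next
  assume "v mod m = r \<and> tp (v div m) = 0"
  then show "v \<in> mult_trans m r thue_morse"
    unfolding mult_trans_def
    by (intro image_eqI[of _ _ "v div m"]) (auto simp: thue_morse_iff)
qed

text \<open>Division by \<open>k * 2 ^ z\<close> in two stages: the last \<open>z\<close> bits are
  compared literally, and the label of what precedes them decides the rest.\<close>

lemma mem_mult_trans_pow2_iff:
  assumes "r div 2 ^ z < k"
  shows "v \<in> mult_trans (k * 2 ^ z) r thue_morse \<longleftrightarrow>
    v mod 2 ^ z = r mod 2 ^ z \<and> residue k (v div 2 ^ z) = (r div 2 ^ z, 0)"
proof -
  have r: "r < k * 2 ^ z" using assms by (simp add: div_less_iff_less_mult)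
  have "v mod (2 ^ z * k) = r \<longleftrightarrow> v mod 2 ^ z = r mod 2 ^ z \<and> v div 2 ^ z mod k = r div 2 ^ z"
    (is "?L \<longleftrightarrow> ?R")
  proof
    assume L: ?L
    \<comment> \<open>The left term is the mixed radix form of \<open>v mod (2 ^ z * k)\<close>; its
      remainder and quotient by \<open>2 ^ z\<close> give the two conditions.\<close>
    have "(2 ^ z * (v div 2 ^ z mod k) + v mod 2 ^ z) mod 2 ^ z = r mod 2 ^ z"
      "(2 ^ z * (v div 2 ^ z mod k) + v mod 2 ^ z) div 2 ^ z = r div 2 ^ z"
      using L by (simp_all add: mod_mult2_eq)
    then show ?R by simp
  next
    assume ?R then show ?L by (simp add: mod_mult2_eq)
  qed
  then show ?thesis
    using mem_mult_trans_iff[OF r, of v]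
    unfolding residue_def mult.commute[of k] by (simp add: div_mult2_eq)
qed

section \<open>Values of words\<close>

lemma val_Nil [simp]: "val b [] = 0" by (simp add: val_def)

lemma val_snoc [simp]: "val b (u @ [a]) = b * val b u + a"
proof -
  have "val b (u @ [a]) = a + (\<Sum>j<length u. rev u ! j * b ^ Suc j)"
    unfolding val_def by (simp add: sum.lessThan_Suc_shift del: sum.lessThan_Suc)
  then show ?thesis by (simp add: val_def sum_distrib_left mult.left_commute)
qed

lemma val_append: "val b (u @ w) = b ^ length w * val b u + val b w"
proof (induction w rule: rev_induct)
  case (snoc a w)
  then show ?case using val_snoc[of b "u @ w" a] by (simp add: algebra_simps)
qed simp

lemma val_replicate_0: "val b (replicate i 0) = 0"
  by (induction i) (simp_all flip: replicate_append_same)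

text \<open>Leading zeros pad a representation to any sufficient length, so every
  \<open>w < b ^ i\<close> is an extension by exactly \<open>i\<close> digits.\<close>

lemma ex_word_length:
  assumes "v < b ^ i"
  shows "\<exists>u\<in>lists {..<b}. length u = i \<and> val b u = v"
  using assms
proof (induction i arbitrary: v)
  case (Suc i)
  have b: "b > 0" using Suc.prems by (cases b) auto
  have "v div b < b ^ i" using Suc.prems b by (simp add: div_less_iff_less_mult mult.commute)
  then obtain u where "u \<in> lists {..<b}" "length u = i" "val b u = v div b" using Suc.IH by blast
  then show ?case using b by (intro bexI[of _ "u @ [v mod b]"]) auto
qed auto

lemma ex_word: "b \<ge> 2 \<Longrightarrow> \<exists>u\<in>lists {..<b}. val b u = v"
proof -
  assume "b \<ge> 2"
  then have "v < b ^ v" using less_exp[of v] power_mono[of 2 b v] by (meson less_le_trans zero_le)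
  then show ?thesis using ex_word_length by blast
qed

text \<open>One extension \<open>w\<close> that puts \<open>x\<close> into the set puts
  \<open>x'\<close> there as well. Comparing the two members modulo \<open>k\<close> gives equal
  residues, because a power of 2 is invertible modulo the odd \<open>k\<close>; comparing their
  quotients by \<open>m\<close> then gives equal parities.\<close>

lemma residue_eq:
  fixes m k z r p x x' :: nat
  assumes m: "m = k * 2 ^ z" and "odd k" and r: "r < m" and p: "p \<ge> 1"
    and ext: "\<And>i w. w < (2 ^ p) ^ i \<Longrightarrow>
      (2 ^ p) ^ i * x + w \<in> mult_trans m r thue_morse \<longleftrightarrow>
      (2 ^ p) ^ i * x' + w \<in> mult_trans m r thue_morse"
  shows "residue k x = residue k x'"
proof -
  \<comment> \<open>The summand \<open>4 * m\<close> makes \<open>B\<close> at least as long as the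
    window in which a member is sought, and \<open>z\<close> makes \<open>2 ^ z\<close> divide
    \<open>B\<close>.\<close>
  define i where "i = 4 * m + z"
  define B :: nat where "B = (2 ^ p) ^ i"
  define g where "g = p * i - z"
  have "z \<le> p * i" using p by (cases p) (auto simp: i_def)
  then have "p * i = z + g" by (simp add: g_def)
  then have B: "B = 2 ^ z * 2 ^ g" by (simp add: B_def power_add flip: power_mult)
  have "i < 2 ^ i" by (rule less_exp)
  also have "(2::nat) ^ i \<le> B" unfolding B_def using p self_le_power[of 2 p] by (intro power_mono) auto
  finally have big: "4 * m \<le> B" by (simp add: i_def)
  have m0: "m > 0" and k0: "k > 0" using r m by (auto intro!: Nat.gr0I)
  \<comment> \<open>\<open>2 * t0\<close> is the first even number with
    \<open>m * (2 * t0) > B * x\<close>. The parities of \<open>2 * t0\<close> and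
    \<open>2 * t0 + 1\<close> are opposite, so one of the two is in \<open>thue_morse\<close>, and
    its member lies between \<open>B * x\<close> and \<open>B * x + 4 * m\<close>.\<close>
  define t0 where "t0 = B * x div (2 * m) + 1"
  have "tp (2 * t0) = 0 \<or> tp (Suc (2 * t0)) = 0"
    using tp_le_1[of t0] unfolding tp_double tp_double_Suc by linarith
  then obtain t where t: "tp t = 0" "2 * t0 \<le> t" "t \<le> Suc (2 * t0)"
    by (elim disjE) simp_all
  define w where "w = m * t + r - B * x"
  have q: "B * x = 2 * m * (B * x div (2 * m)) + B * x mod (2 * m)" by simp
  have q2: "B * x mod (2 * m) < 2 * m" using m0 by simp
  have eq0: "m * (2 * t0) = 2 * m * (B * x div (2 * m)) + 2 * m" by (simp add: t0_def algebra_simps)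
  have "m * (2 * t0) \<le> m * t" using t(2) by simp
  then have le: "B * x \<le> m * t" using q q2 eq0 by linarith
  have "m * t \<le> m * Suc (2 * t0)" using t(3) by (intro mult_le_mono) auto
  then have lt: "m * t + r < B * x + 4 * m" using q q2 eq0 r unfolding mult_Suc_right by linarith
  have wB: "w < B" using le lt big unfolding w_def by linarith
  have in1: "B * x + w \<in> mult_trans m r thue_morse"
  proof -
    have "B * x + w = m * t + r" using le by (simp add: w_def)
    then show ?thesis using t(1) by (auto simp: mult_trans_def thue_morse_iff)
  qed
  then have in2: "B * x' + w \<in> mult_trans m r thue_morse" using ext[of w i] wB by (simp add: B_def)
  note mem = mem_mult_trans_iff[OF r]
  have "[B * x + w = B * x' + w] (mod m)" using in1 in2 by (simp add: mem cong_def)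
  then have "[B * x + w = B * x' + w] (mod k)" unfolding m by (rule cong_dvd_modulus_nat) simp
  then have "[B * x = B * x'] (mod k)" by (simp add: cong_add_rcancel_nat)
  moreover have "coprime B k" unfolding B_def using \<open>odd k\<close> by simp
  ultimately have "[x = x'] (mod k)" by (simp add: cong_mult_lcancel_nat)
  then have s: "x mod k = x' mod k" by (simp add: cong_def)
  \<comment> \<open>Only the residue of \<open>x\<close> enters \<open>c\<close>, so
    \<open>c\<close> is the same low part of the quotient by \<open>k\<close> for both numbers;
    \<open>c < B\<close> keeps it apart from \<open>B * (y div k)\<close>.\<close>
  define c where "c = (B * (x mod k) + w) div k"
  have "B * (x mod k) + w < k * B"
  proof -
    have "B * (x mod k) + w < B * Suc (x mod k)" using wB by simp
    also have "\<dots> \<le> B * k" using k0 by (intro mult_le_mono) (auto simp: Suc_leI)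
    finally show ?thesis by (simp add: mult.commute)
  qed
  then have "c < B" unfolding c_def using k0 by (simp add: div_less_iff_less_mult mult.commute)
  then have c: "c div 2 ^ z < 2 ^ g" unfolding B by (simp add: div_less_iff_less_mult mult.commute)
  \<comment> \<open>The quotient by \<open>m\<close> consists of the digits of
    \<open>y div k\<close> followed by \<open>g\<close> digits of \<open>c div 2 ^ z\<close>. Its
    parity is even, so the common low part determines the parity of the high part.\<close>
  have par: "tp (y div k) = tp (c div 2 ^ z)"
    if y: "B * y + w \<in> mult_trans m r thue_morse" and ys: "y mod k = x mod k" for y
  proof -
    have e: "B * y + w = (B * (x mod k) + w) + k * (B * (y div k))"
    proof -
      have "B * y = B * (k * (y div k) + y mod k)" by simp
      then show ?thesis using ys by (simp add: algebra_simps)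
    qed
    have "(B * y + w) div k = B * (y div k) + c"
      unfolding e c_def using k0 by (simp only: div_mult_self2)
    then have "(B * y + w) div m = (B * (y div k) + c) div 2 ^ z"
      by (simp add: m div_mult2_eq)
    also have "\<dots> = 2 ^ g * (y div k) + c div 2 ^ z"
    proof -
      have "B * (y div k) + c = c + 2 ^ z * (2 ^ g * (y div k))" by (simp add: B)
      then show ?thesis by (simp only:) (subst div_mult_self2, simp_all)
    qed
    finally have "tp (2 ^ g * (y div k) + c div 2 ^ z) = 0" using y by (simp add: mem)
    then have "(tp (y div k) + tp (c div 2 ^ z)) mod 2 = 0" by (simp only: tp_append[OF c])
    then show ?thesis using tp_le_1[of "y div k"] tp_le_1[of "c div 2 ^ z"] by (auto simp: le_Suc_eq)
  qed
  show ?thesis using par[OF in1] par[OF in2] s by (simp add: residue_def)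
qed

lemma ex_odd_mult_pow2:
  fixes m :: nat
  shows "m \<noteq> 0 \<Longrightarrow> \<exists>k z. m = k * 2 ^ z \<and> odd k"
proof (induction m rule: less_induct)
  case (less m)
  show ?case
  proof (cases "even m")
    case True
    then obtain h where h: "m = 2 * h" by (elim evenE)
    then have "h < m" "h \<noteq> 0" using less.prems by simp_all
    then obtain k z where k: "h = k * 2 ^ z" "odd k" using less.IH by blast
    then show ?thesis using h by (intro exI[of _ k] exI[of _ "Suc z"]) simp
  next
    case False
    then show ?thesis by (metis mult_1_right power_0)
  qed
qed

section \<open>Dropping a common last digit\<close>

definition thue_morse_shift :: "nat set \<Rightarrow> nat \<Rightarrow> bool" where
  "thue_morse_shift Y r \<longleftrightarrow> (\<exists>m\<ge>1. r < m \<and> Y = mult_trans m r thue_morse)"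

text \<open>\<open>b * m * t + r\<close> has last digit \<open>r mod b\<close>, and deleting it
  leaves \<open>m * t + r div b\<close>.\<close>

lemma mult_trans_div:
  assumes "b > 0"
  shows "{v. b * v + r mod b \<in> mult_trans (b * m) r X} = mult_trans m (r div b) X"
proof -
  have "b * v + r mod b = b * m * t + r \<longleftrightarrow> v = m * t + r div b" for v t
  proof -
    have "b * m * t + r = b * (m * t + r div b) + r mod b" by (simp add: algebra_simps)
    then show ?thesis using assms by simp
  qed
  then show ?thesis by (auto simp: mult_trans_def image_iff)
qed

text \<open>The members for \<open>t = 0\<close> and \<open>t = 3\<close> differ by
  \<open>3 * m\<close>, and 3 is coprime to powers of 2.\<close>

lemma dvd_if_mult_trans_cong:
  assumes "Y = mult_trans m r thue_morse" "\<forall>v\<in>Y. v mod 2 ^ p = d"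
  shows "2 ^ p dvd m"
proof -
  have "m * 0 + r \<in> Y" "m * 3 + r \<in> Y" using tp_3
    by (auto simp: assms(1) mult_trans_def thue_morse_iff intro!: imageI simp del: mult_0_right)
  then have "[m * 3 + r = 0 + r] (mod 2 ^ p)" using assms(2) by (simp add: cong_def)
  then have "2 ^ p dvd m * 3" by (simp only: cong_add_rcancel_nat cong_0_iff)
  moreover have "coprime (2 ^ p) (3::nat)" by simp
  ultimately show ?thesis by (metis coprime_dvd_mult_left_iff)
qed

text \<open>The converse of \<open>mult_trans_div\<close>: a set whose elements share the last digit
  is recovered from its truncation.\<close>

lemma mult_trans_of_div:
  assumes "\<forall>v\<in>Y. v mod b = r mod b" and "b > 0"
    and Y': "{v. b * v + r mod b \<in> Y} = mult_trans m (r div b) X"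
  shows "Y = mult_trans (b * m) r X"
proof (rule set_eqI)
  fix v
  have Z: "{v. b * v + r mod b \<in> Y} = {v. b * v + r mod b \<in> mult_trans (b * m) r X}"
    using \<open>b > 0\<close> by (simp add: Y' mult_trans_div)
  show "v \<in> Y \<longleftrightarrow> v \<in> mult_trans (b * m) r X"
  proof (cases "v mod b = r mod b")
    case True
    then have "v = b * (v div b) + r mod b" by (metis mult_div_mod_eq)
    then show ?thesis using Z by (metis (mono_tags, lifting) mem_Collect_eq)
  next
    case False
    moreover have "v \<notin> mult_trans (b * m) r X"
    proof
      assume "v \<in> mult_trans (b * m) r X"
      then have "\<exists>t. v = r + b * (m * t)" by (auto simp: mult_trans_def)
      then obtain t where "v = r + b * (m * t)" ..
      then show False using False by simp
    qed
    ultimately show ?thesis using assms(1) by blast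
  qed
qed

text \<open>Correctness of dropping a digit: the multiplier \<open>m\<close> corresponds to
  \<open>m div 2 ^ p\<close>, and the bound on the remainder carries over in both
  directions.\<close>

lemma thue_morse_shift_div_iff:
  assumes "\<forall>v\<in>Y. v mod 2 ^ p = r mod 2 ^ p"
  shows "thue_morse_shift {v. 2 ^ p * v + r mod 2 ^ p \<in> Y} (r div 2 ^ p) \<longleftrightarrow> thue_morse_shift Y r"
    (is "thue_morse_shift ?Y' _ \<longleftrightarrow> _")
proof
  assume "thue_morse_shift ?Y' (r div 2 ^ p)"
  then obtain m where m: "m \<ge> 1" "r div 2 ^ p < m" "?Y' = mult_trans m (r div 2 ^ p) thue_morse"
    unfolding thue_morse_shift_def by blast
  have "Y = mult_trans (2 ^ p * m) r thue_morse"
    by (rule mult_trans_of_div[OF assms _ m(3)]) simp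
  moreover have "r < 2 ^ p * m" using m(2) by (simp add: div_less_iff_less_mult mult.commute)
  ultimately show "thue_morse_shift Y r"
    unfolding thue_morse_shift_def using m(1) by (intro exI[of _ "2 ^ p * m"]) auto
next
  assume "thue_morse_shift Y r"
  then obtain m where m: "r < m" "Y = mult_trans m r thue_morse"
    unfolding thue_morse_shift_def by blast
  obtain m' where m': "m = 2 ^ p * m'" using dvd_if_mult_trans_cong[OF m(2) assms] by (elim dvdE)
  have "r div 2 ^ p < m'" using m(1) m' by (simp add: div_less_iff_less_mult mult.commute)
  moreover have "?Y' = mult_trans m' (r div 2 ^ p) thue_morse"
    using mult_trans_div[of "2 ^ p" r m' thue_morse] by (simp add: m(2) m')
  ultimately show "thue_morse_shift ?Y' (r div 2 ^ p)"
    unfolding thue_morse_shift_def by (intro exI[of _ m']) auto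
qed

section \<open>Complete automata recognizing a shifted multiple of the Thue-Morse set\<close>

text \<open>The transition function is total, so \<open>foldl\<close> is the run. The final states
  stay outside the locale because dropping digits changes them while the transitions remain.\<close>

locale complete_dfa =
  fixes p n q0 :: nat and \<delta> :: "nat \<Rightarrow> nat \<Rightarrow> nat"
  assumes p_pos: "p \<ge> 1" and q0_less: "q0 < n"
    and \<delta>_less: "\<And>q a. q < n \<Longrightarrow> a < 2 ^ p \<Longrightarrow> \<delta> q a < n"
begin

abbreviation "b \<equiv> (2::nat) ^ p"
abbreviation "words \<equiv> lists {..<b}"
abbreviation "reach u \<equiv> foldl \<delta> q0 u"

definition accepts :: "nat set \<Rightarrow> nat set \<Rightarrow> bool" where
  "accepts F Y \<longleftrightarrow> (\<forall>u\<in>words. reach u \<in> F \<longleftrightarrow> val b u \<in> Y)"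

text \<open>What one search decides: labels depend on the reached state only, and every edge passes
  \<open>chk\<close>, which sees the letter, the label of the source and the finality of the target.
  Generality in \<open>st\<close> and \<open>chk\<close> covers both the last-digit test and the
  residue test.\<close>

definition consistent ::
  "nat set \<Rightarrow> (nat \<Rightarrow> 'v \<Rightarrow> 'v) \<Rightarrow> (nat \<Rightarrow> 'v \<Rightarrow> bool \<Rightarrow> bool) \<Rightarrow> 'v \<Rightarrow> bool" where
  "consistent F st chk v0 \<longleftrightarrow>
     (\<forall>u\<in>words. \<forall>u'\<in>words. reach u = reach u' \<longrightarrow>
        foldl (\<lambda>v a. st a v) v0 u = foldl (\<lambda>v a. st a v) v0 u') \<and>
     (\<forall>u\<in>words. \<forall>a<b. chk a (foldl (\<lambda>v a. st a v) v0 u) (\<delta> (reach u) a \<in> F))"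

section \<open>Bounds from counting states\<close>

lemma b_ge_2: "b \<ge> 2"
  using p_pos self_le_power[of 2 p] by simp

lemma n_pos: "n > 0" using q0_less by simp

lemma reach_less: "u \<in> words \<Longrightarrow> reach u < n"
  by (induction u rule: rev_induct) (auto simp: q0_less \<delta>_less)

text \<open>Words that reach one state have the same accepted extensions, in the manner of Myhill
  and Nerode; this is the hypothesis of \<open>residue_eq\<close>.\<close>

lemma reach_eq_residue_eq:
  assumes acc: "accepts F (mult_trans m r thue_morse)" and m: "m = k * 2 ^ z" "odd k" "r < m"
    and u: "u \<in> words" "u' \<in> words" "reach u = reach u'"
  shows "residue k (val b u) = residue k (val b u')"
proof (rule residue_eq[OF m p_pos])
  fix i w assume "w < b ^ i"
  then obtain x where x: "x \<in> words" "length x = i" "val b x = w" using ex_word_length by blast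
  have "reach (u @ x) = reach (u' @ x)" using u(3) by simp
  then show "b ^ i * val b u + w \<in> mult_trans m r thue_morse \<longleftrightarrow>
    b ^ i * val b u' + w \<in> mult_trans m r thue_morse"
    using acc u x by (simp only: accepts_def val_append flip: x) (metis append_in_lists_conv val_append)
qed

text \<open>Words for \<open>0, ..., k - 1\<close> have different residues and hence reach different
  states.\<close>

lemma odd_part_le:
  assumes "accepts F (mult_trans m r thue_morse)" "m = k * 2 ^ z" "odd k" "r < m"
  shows "k \<le> n"
proof -
  obtain w where w: "\<And>i. w i \<in> words" "\<And>i. val b (w i) = i"
    using ex_word[OF b_ge_2] by metis
  have "inj_on (\<lambda>i. reach (w i)) {..<k}"
  proof (rule inj_onI)
    fix i j assume ij: "i \<in> {..<k}" "j \<in> {..<k}" "reach (w i) = reach (w j)"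
    have "residue k i = residue k j"
      using reach_eq_residue_eq[OF assms w(1) w(1) ij(3)] by (simp add: w(2))
    then show "i = j" using ij by (simp add: residue_def)
  qed
  moreover have "(\<lambda>i. reach (w i)) ` {..<k} \<subseteq> {..<n}" using reach_less w(1) by auto
  ultimately show ?thesis using card_inj_on_le[of _ "{..<k}" "{..<n}"] by simp
qed

lemma power_not_accepted:
  assumes "m \<ge> 1"
  shows "\<not> accepts F (mult_trans (b ^ n * m) 0 thue_morse)"
proof
  assume acc: "accepts F (mult_trans (b ^ n * m) 0 thue_morse)"
  obtain u where u: "u \<in> words" "val b u = 3 * m" using ex_word[OF b_ge_2] by blast
  define w where "w i = u @ replicate i 0" for i
  have w: "w i \<in> words" for i using u b_ge_2 by (auto simp: w_def)
  have vw: "val b (w i) = b ^ i * (3 * m)" for i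
    by (simp add: w_def val_append val_replicate_0 u(2))
  have "\<not> inj_on (\<lambda>i. reach (w i)) {..n}"
  proof
    assume "inj_on (\<lambda>i. reach (w i)) {..n}"
    moreover have "(\<lambda>i. reach (w i)) ` {..n} \<subseteq> {..<n}" using reach_less w by auto
    ultimately show False using card_inj_on_le[of _ "{..n}" "{..<n}"] by simp
  qed
  then obtain i j where ij: "i < j" "j \<le> n" "reach (w i) = reach (w j)"
    unfolding inj_on_def by (metis atMost_iff linorder_neqE_nat)
  have split: "w (i' + d) = w i' @ replicate d 0" for i' d by (simp add: w_def replicate_add)
  \<comment> \<open>Appending \<open>n - j\<close> zeros to the colliding words turns the longer one
    into \<open>w n\<close>, which is accepted.\<close>
  have "reach (w (i + (n - j))) = reach (w (j + (n - j)))"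
    unfolding split foldl_append ij(3) ..
  then have "val b (w (i + (n - j))) \<in> mult_trans (b ^ n * m) 0 thue_morse \<longleftrightarrow>
      val b (w n) \<in> mult_trans (b ^ n * m) 0 thue_morse"
    using acc w ij unfolding accepts_def by (metis le_add_diff_inverse)
  moreover have "val b (w n) \<in> mult_trans (b ^ n * m) 0 thue_morse"
    unfolding vw mult_trans_def by (rule image_eqI[of _ _ 3]) (simp_all add: thue_morse_iff tp_3)
  ultimately obtain t where t: "b ^ (i + (n - j)) * (3 * m) = b ^ n * m * t"
    by (auto simp: vw mult_trans_def)
  have "n = (i + (n - j)) + (j - i)" using ij by simp
  then have "b ^ n = b ^ (i + (n - j)) * b ^ (j - i)" by (metis power_add)
  \<comment> \<open>Cancelling the common factors leaves the odd number 3 as a multiple of a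
    positive power of \<open>b\<close>.\<close>
  with t have "3 = b ^ (j - i) * t" using assms by simp
  moreover have "even (b ^ (j - i))" using p_pos ij by simp
  ultimately show False by (metis dvd_mult2 odd_numeral)
qed

section \<open>Right quotients and consistency in terms of numbers\<close>

lemma accepts_shift:
  assumes "accepts F Y" "d < b"
  shows "accepts {q. q < n \<and> \<delta> q d \<in> F} {v. b * v + d \<in> Y}"
  unfolding accepts_def
proof
  fix u assume u: "u \<in> words"
  then have "u @ [d] \<in> words" using assms(2) by simp
  then have "reach (u @ [d]) \<in> F \<longleftrightarrow> val b (u @ [d]) \<in> Y"
    using assms(1) unfolding accepts_def by (rule bspec[rotated])
  then show "reach u \<in> {q. q < n \<and> \<delta> q d \<in> F} \<longleftrightarrow> val b u \<in> {v. b * v + d \<in> Y}"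
    using reach_less[OF u] by simp
qed

text \<open>A word \<open>u\<close> with a further letter \<open>a\<close> is a nonempty word, and
  \<open>v div b\<close>, \<open>v mod b\<close> are the values of its prefix and last letter. As
  each number has a nonempty representation, words can be traded for numbers.\<close>

lemma ball_snoc:
  assumes "accepts F Y"
  shows "(\<forall>u\<in>words. \<forall>a<b. P (val b u) a (\<delta> (reach u) a \<in> F)) \<longleftrightarrow>
    (\<forall>v. P (v div b) (v mod b) (v \<in> Y))"
proof -
  have *: "\<delta> (reach u) a \<in> F \<longleftrightarrow> b * val b u + a \<in> Y" if "u \<in> words" "a < b" for u a
    using assms that unfolding accepts_def by (auto dest!: bspec[of _ _ "u @ [a]"])
  show ?thesis
  proof (intro iffI allI ballI impI)
    fix v assume L: "\<forall>u\<in>words. \<forall>a<b. P (val b u) a (\<delta> (reach u) a \<in> F)"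
    obtain u where u: "u \<in> words" "val b u = v div b" using ex_word[OF b_ge_2] by blast
    have "v mod b < b" by simp
    then show "P (v div b) (v mod b) (v \<in> Y)"
      using L[rule_format, of u "v mod b"] u *[OF u(1), of "v mod b"] by simp
  next
    fix u a assume "\<forall>v. P (v div b) (v mod b) (v \<in> Y)" "u \<in> words" "a < b"
    then show "P (val b u) a (\<delta> (reach u) a \<in> F)"
      using * by (auto dest!: spec[of _ "b * val b u + a"])
  qed
qed

text \<open>The label never changes, so only the edge check remains; it rejects an accepted nonempty
  word with another last digit.\<close>

lemma consistent_peel_iff:
  assumes "accepts F Y"
  shows "consistent F (\<lambda>a v. v) (\<lambda>a v f. a = d \<or> \<not> f) v0 \<longleftrightarrow> (\<forall>v\<in>Y. v mod b = d)"
proof -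
  have "foldl (\<lambda>v a. v) v0 u = v0" for u :: "nat list" by (induction u) auto
  then show ?thesis
    unfolding consistent_def using ball_snoc[OF assms, of "\<lambda>_ a f. a = d \<or> \<not> f"] by auto
qed

text \<open>The digit is fed in two groups of bits so that the label between them is the one that
  \<open>residue_check\<close> inspects.\<close>

definition residue_step :: "nat \<Rightarrow> nat \<Rightarrow> nat \<Rightarrow> nat \<times> nat \<Rightarrow> nat \<times> nat" where
  "residue_step k z a v = bitsteps k z (a mod 2 ^ z) (bitsteps k (p - z) (a div 2 ^ z) v)"

text \<open>
  Whether a word is accepted depends on its last \<open>z\<close> bits and on the label of the preceding bits, so
  it is decided in the middle of the last digit.
\<close>

definition residue_check :: "nat \<Rightarrow> nat \<Rightarrow> nat \<Rightarrow> nat \<Rightarrow> nat \<times> nat \<Rightarrow> bool \<Rightarrow> bool" where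
  "residue_check k z r a v f \<longleftrightarrow>
     f = (a mod 2 ^ z = r mod 2 ^ z \<and> bitsteps k (p - z) (a div 2 ^ z) v = (r div 2 ^ z, 0))"

lemma div_pow2_digit:
  assumes "z \<le> p"
  shows "(b * v + a) div 2 ^ z = 2 ^ (p - z) * v + a div 2 ^ z"
    "(b * v + a) mod 2 ^ z = a mod 2 ^ z"
proof -
  have "b = 2 ^ z * 2 ^ (p - z)" using assms by (simp flip: power_add)
  then have e: "b * v + a = a + 2 ^ z * (2 ^ (p - z) * v)" by simp
  show "(b * v + a) div 2 ^ z = 2 ^ (p - z) * v + a div 2 ^ z"
    unfolding e by (subst div_mult_self2) simp_all
  show "(b * v + a) mod 2 ^ z = a mod 2 ^ z" unfolding e by simp
qed

lemma bitsteps_high: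
  assumes "z \<le> p" "k > 0" "a < b"
  shows "bitsteps k (p - z) (a div 2 ^ z) (residue k v) = residue k ((b * v + a) div 2 ^ z)"
proof -
  have "a div 2 ^ z < 2 ^ (p - z)" using assms
    by (simp add: div_less_iff_less_mult flip: power_add)
  then show ?thesis using assms by (simp add: bitsteps_residue div_pow2_digit)
qed

lemma residue_step:
  assumes "z \<le> p" "k > 0" "a < b"
  shows "residue_step k z a (residue k v) = residue k (b * v + a)"
proof -
  have "2 ^ z * ((b * v + a) div 2 ^ z) + (b * v + a) mod 2 ^ z = b * v + a" by simp
  then show ?thesis using assms
    by (simp add: residue_step_def bitsteps_high bitsteps_residue flip: div_pow2_digit(2)[OF assms(1), of v a])
qed

lemma foldl_residue_step:
  assumes "z \<le> p" "k > 0" "u \<in> words"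
  shows "foldl (\<lambda>v a. residue_step k z a v) (0, 0) u = residue k (val b u)"
  using assms(3)
proof (induction u rule: rev_induct)
  case Nil
  then show ?case by (simp add: residue_def)
qed (simp add: residue_step assms)

text \<open>By \<open>mem_mult_trans_pow2_iff\<close> the edge checks say exactly that
  \<open>Y\<close> is the candidate set. That labels depend on the state stays a separate condition,
  which \<open>reach_eq_residue_eq\<close> supplies for odd \<open>k\<close>.\<close>

lemma consistent_residue_iff:
  assumes "accepts F Y" "z \<le> p" "r div 2 ^ z < k"
  shows "consistent F (residue_step k z) (residue_check k z r) (0, 0) \<longleftrightarrow>
    (\<forall>u\<in>words. \<forall>u'\<in>words. reach u = reach u' \<longrightarrow> residue k (val b u) = residue k (val b u')) \<and>
    Y = mult_trans (k * 2 ^ z) r thue_morse"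
proof -
  have k: "k > 0" using assms(3) by simp
  have "residue_check k z r (v mod b) (residue k (v div b)) (v \<in> Y) \<longleftrightarrow>
      (v \<in> Y \<longleftrightarrow> v \<in> mult_trans (k * 2 ^ z) r thue_morse)" for v
    using div_pow2_digit[OF assms(2), of "v div b" "v mod b"]
      bitsteps_high[OF assms(2) k, of "v mod b" "v div b"]
    by (simp add: residue_check_def mem_mult_trans_pow2_iff[OF assms(3)])
  then have "(\<forall>u\<in>words. \<forall>a<b. residue_check k z r a (residue k (val b u)) (\<delta> (reach u) a \<in> F)) \<longleftrightarrow>
      Y = mult_trans (k * 2 ^ z) r thue_morse"
    unfolding ball_snoc[OF assms(1), of "\<lambda>v a f. residue_check k z r a (residue k v) f"] by auto
  then show ?thesis
    unfolding consistent_def using foldl_residue_step[OF assms(2) k] by simp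
qed

text \<open>Soundness holds for every \<open>k\<close> tried. For completeness \<open>k\<close> is
  the odd part of \<open>m\<close>: \<open>odd_part_le\<close> bounds it by \<open>n\<close>, and
  \<open>stuck\<close> forces the exponent \<open>z\<close> below \<open>p\<close>.\<close>

lemma thue_morse_shift_iff_consistent:
  assumes acc: "accepts F Y"
    and stuck: "\<And>m. r < m \<Longrightarrow> Y = mult_trans m r thue_morse \<Longrightarrow> \<not> b dvd m"
  shows "thue_morse_shift Y r \<longleftrightarrow>
    (\<exists>z<p. \<exists>k. r div 2 ^ z < k \<and> k \<le> n \<and>
      consistent F (residue_step k z) (residue_check k z r) (0, 0))"
proof
  assume "thue_morse_shift Y r"
  then obtain m where m: "r < m" "Y = mult_trans m r thue_morse"
    unfolding thue_morse_shift_def by blast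
  have "m \<noteq> 0" using m by simp
  then have "\<exists>k z. m = k * 2 ^ z \<and> odd k" by (rule ex_odd_mult_pow2)
  then obtain k z where k: "m = k * 2 ^ z" "odd k" by blast
  have "z < p"
  proof (rule ccontr)
    assume "\<not> z < p"
    then have "b dvd m" unfolding k(1) by (simp add: le_imp_power_dvd dvd_mult)
    then show False using stuck m by blast
  qed
  moreover have "r div 2 ^ z < k" using m k by (simp add: div_less_iff_less_mult)
  moreover have "k \<le> n" using odd_part_le[OF _ k m(1)] acc m(2) by blast
  moreover have "residue k (val b u) = residue k (val b u')"
    if "u \<in> words" "u' \<in> words" "reach u = reach u'" for u u'
    using reach_eq_residue_eq[OF _ k m(1) that] acc m(2) by blast
  ultimately show "\<exists>z<p. \<exists>k. r div 2 ^ z < k \<and> k \<le> n \<and>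
      consistent F (residue_step k z) (residue_check k z r) (0, 0)"
    using consistent_residue_iff[OF acc less_imp_le[of z p], of r k] m(2) k(1) by blast
next
  assume "\<exists>z<p. \<exists>k. r div 2 ^ z < k \<and> k \<le> n \<and>
      consistent F (residue_step k z) (residue_check k z r) (0, 0)"
  then obtain z k where "z < p" and k: "r div 2 ^ z < k"
      "consistent F (residue_step k z) (residue_check k z r) (0, 0)"
    by blast
  then have "Y = mult_trans (k * 2 ^ z) r thue_morse"
    using consistent_residue_iff[OF acc less_imp_le k(1)] k(2) by blast
  moreover have "r < k * 2 ^ z" using k(1) by (simp add: div_less_iff_less_mult)
  ultimately show "thue_morse_shift Y r"
    unfolding thue_morse_shift_def using k(1) by (intro exI[of _ "k * 2 ^ z"]) auto
qed

end

section \<open>Weakest preconditions with running time\<close>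

text \<open>Total correctness with cost: termination is asserted, and the postcondition also
  receives the number of steps.\<close>

definition wp :: "com \<Rightarrow> (nat \<Rightarrow> state \<Rightarrow> bool) \<Rightarrow> state \<Rightarrow> bool" where
  "wp c Q s \<longleftrightarrow> (\<exists>t s'. exec c s t s' \<and> Q t s')"

lemma wp_mono: "wp c Q s \<Longrightarrow> (\<And>t s'. Q t s' \<Longrightarrow> Q' t s') \<Longrightarrow> wp c Q' s"
  unfolding wp_def by blast

lemma wp_Seq: "wp (Seq c d) Q s \<longleftrightarrow> wp c (\<lambda>t s'. wp d (\<lambda>t' s''. Q (t + t') s'') s') s"
  unfolding wp_def by (blast intro: exec.Seq elim: exec_SeqE)

lemma wp_If:
  "wp (If_nz i c d) Q s \<longleftrightarrow>
    (if reg s i \<noteq> 0 then wp c (\<lambda>t. Q (Suc t)) s else wp d (\<lambda>t. Q (Suc t)) s)"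
  unfolding wp_def by (auto elim!: exec_IfE) (metis exec.If_True exec.If_False plus_1_eq_Suc neq0_conv)+

lemma wp_step: "exec c s 1 s' \<Longrightarrow> wp c Q s \<longleftrightarrow> Q 1 s'"
  unfolding wp_def using exec_deterministic by blast

lemma wp_basic:
  "wp Skip Q s \<longleftrightarrow> Q 1 s"
  "wp (Const i m) Q s \<longleftrightarrow> Q 1 (s\<lparr>reg := (reg s)(i := m)\<rparr>)"
  "wp (Add i j k) Q s \<longleftrightarrow> Q 1 (s\<lparr>reg := (reg s)(i := reg s j + reg s k)\<rparr>)"
  "wp (Sub i j k) Q s \<longleftrightarrow> Q 1 (s\<lparr>reg := (reg s)(i := reg s j - reg s k)\<rparr>)"
  "wp (Load i j) Q s \<longleftrightarrow> Q 1 (s\<lparr>reg := (reg s)(i := mem s (reg s j))\<rparr>)"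
  "wp (Store i j) Q s \<longleftrightarrow> Q 1 (s\<lparr>mem := (mem s)(reg s i := reg s j)\<rparr>)"
  by (rule wp_step, rule exec.intros)+

text \<open>\<open>m\<close> is a variant that bounds the remaining iterations and may drop by more
  than one. An iteration costs at most \<open>K\<close> and a test; the final 1 is the last
  test.\<close>

lemma wp_while:
  assumes "\<And>m s. I m s \<Longrightarrow> reg s i \<noteq> 0 \<Longrightarrow> wp c (\<lambda>t s'. t \<le> K \<and> (\<exists>m'<m. I m' s')) s"
    and "I m s"
  shows "wp (While_nz i c) (\<lambda>t s'. t \<le> Suc K * m + 1 \<and> (\<exists>m'. I m' s') \<and> reg s' i = 0) s"
  using assms(2)
proof (induction m arbitrary: s rule: less_induct)
  case (less m)
  show ?case
  proof (cases "reg s i = 0")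
    case True
    then have "exec (While_nz i c) s 1 s" by (rule exec.While_False)
    then show ?thesis unfolding wp_def using less.prems True
      by (intro exI[of _ 1] exI[of _ s]) auto
  next
    case False
    then obtain t s' m' where 1: "exec c s t s'" "t \<le> K" "m' < m" "I m' s'"
      using assms(1)[OF less.prems] unfolding wp_def by blast
    obtain t' s'' where 2: "exec (While_nz i c) s' t' s''" "t' \<le> Suc K * m' + 1"
        "\<exists>m'. I m' s''" "reg s'' i = 0"
      using less.IH[OF 1(3,4)] unfolding wp_def by blast
    have "Suc K * Suc m' \<le> Suc K * m" using 1(3) by (intro mult_le_mono) auto
    then have "1 + t + t' \<le> Suc K * m + 1" using 1(2) 2(2) by simp
    then show ?thesis unfolding wp_def using exec.While_True[of s i c t s' t' s''] False 1 2 by blast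
  qed
qed

lemma wp_for:
  assumes "\<And>m s. I (Suc m) s \<Longrightarrow> wp c (\<lambda>t s'. t \<le> K \<and> I m s') s"
    and "\<And>m s. I m s \<Longrightarrow> reg s i = m" and "I m s"
  shows "wp (While_nz i c) (\<lambda>t s'. t \<le> Suc K * m + 1 \<and> I 0 s') s"
proof (rule wp_mono[OF wp_while[where I = I and K = K]])
  fix m s assume I: "I m s" "reg s i \<noteq> 0"
  then obtain m' where m': "m = Suc m'" using assms(2) by (cases m) auto
  show "wp c (\<lambda>t s'. t \<le> K \<and> (\<exists>m'<m. I m' s')) s"
    by (rule wp_mono[OF assms(1)[of m']]) (use I m' in auto)
qed (use assms in auto)

fun block :: "com list \<Rightarrow> com" where
  "block [] = Skip"
| "block (c # cs) = Seq c (block cs)"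

declare block.simps [simp del]

lemma wp_block:
  "wp (block []) Q s \<longleftrightarrow> Q 1 s"
  "wp (block (c # cs)) Q s \<longleftrightarrow> wp c (\<lambda>t s'. wp (block cs) (\<lambda>t' s''. Q (t + t') s'') s') s"
  by (simp_all add: block.simps wp_basic wp_Seq)

lemmas wp_simps = wp_Seq wp_If wp_basic wp_block

text \<open>Unrolled when the program is written: here the number of copies depends on
  \<open>p\<close>, never on the input automaton.\<close>

fun iterate :: "nat \<Rightarrow> (nat \<Rightarrow> com) \<Rightarrow> com" where
  "iterate 0 f = Skip"
| "iterate (Suc j) f = Seq (iterate j f) (f j)"

lemma wp_iterate:
  assumes "\<And>j s. j < m \<Longrightarrow> I j s \<Longrightarrow> wp (f j) (\<lambda>t s'. t \<le> K \<and> I (Suc j) s') s" and "I 0 s"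
  shows "wp (iterate m f) (\<lambda>t s'. t \<le> K * m + 1 \<and> I m s') s"
  using assms(1)
proof (induction m)
  case 0
  then show ?case using assms(2) by (simp add: wp_simps)
next
  case (Suc m)
  have "wp (iterate m f) (\<lambda>t s'. t \<le> K * m + 1 \<and> I m s') s" using Suc by simp
  then show ?case unfolding iterate.simps wp_Seq
    by (rule wp_mono) (rule wp_mono[OF Suc.prems[of m]], auto)
qed

text \<open>The machine has no multiplication; \<open>p\<close> doublings multiply by
  \<open>2 ^ p\<close>.\<close>

lemma wp_doubling:
  "wp (iterate p (\<lambda>_. Add i i i))
    (\<lambda>t s'. t \<le> p + 1 \<and> s' = s\<lparr>reg := (reg s)(i := reg s i * 2 ^ p)\<rparr>) s"
proof -
  have "wp (iterate p (\<lambda>_. Add i i i))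
      (\<lambda>t s'. t \<le> 1 * p + 1 \<and> s' = s\<lparr>reg := (reg s)(i := reg s i * 2 ^ p)\<rparr>) s"
    by (rule wp_iterate) (auto simp: wp_simps fun_eq_iff)
  then show ?thesis by simp
qed

section \<open>The decision program\<close>

text \<open>
  Registers: 0 result, 1 number of states, 2 transition table, 3 final flags, 4 auxiliary array,
  5 residues plus one (0 if unvisited), 6 parities, 7 stack, 8 the constant 1, 9 initial state,
  10 modulus, 11 outer loop counter, 12 stack pointer or inner loop counter, 14 failure flag,
  15 source and 16 target of an edge, 17 residue and 18 parity of the source, 19 final flag of the
  target, 20 to 23 scratch, 25 table address.
\<close>

definition differ_prog :: "nat \<Rightarrow> nat \<Rightarrow> com" where
  "differ_prog i j = block [Sub 23 i j, If_nz 23 (Const 14 1) Skip,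
     Sub 23 j i, If_nz 23 (Const 14 1) Skip]"

definition compare_prog :: com where
  "compare_prog = block [Add 22 6 16, Load 22 22, differ_prog 18 22, differ_prog 17 21]"

text \<open>\<open>E a\<close> maps the label in 17 and 18 to that of the target. The residue is
  decremented before and incremented after it, because the array stores residues plus one with 0 for
  unvisited.\<close>

definition visit_edge :: "(nat \<Rightarrow> com) \<Rightarrow> nat \<Rightarrow> com" where
  "visit_edge E a = Seq
     (block [Const 20 a, Add 20 25 20, Load 16 20, Add 20 5 15, Load 17 20, Sub 17 17 8,
        Add 20 6 15, Load 18 20, Add 20 3 16, Load 19 20])
     (Seq (E a)
     (block [Add 17 17 8, Add 20 5 16, Load 21 20,
        If_nz 21
          compare_prog
          (block [Store 20 17, Add 20 6 16, Store 20 18, Add 20 7 12, Store 20 16, Add 12 12 8])]))"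

definition expand_prog :: "nat \<Rightarrow> (nat \<Rightarrow> com) \<Rightarrow> com" where
  "expand_prog p E = block
     [Sub 12 12 8, Add 20 7 12, Load 15 20, Const 20 0, Add 25 15 20,
      iterate p (\<lambda>_. Add 25 25 25), Add 25 25 2, iterate (2 ^ p) (visit_edge E)]"

definition clear_prog :: com where
  "clear_prog = block
     [Const 20 0, Add 12 1 20,
      While_nz 12 (block [Sub 12 12 8, Add 20 5 12, Const 21 0, Store 20 21])]"

text \<open>The start label is \<open>(0, 0)\<close>: \<open>Store 20 8\<close> writes 1, which is
  the residue 0 plus one, and \<open>Store 20 14\<close> writes the parity 0.\<close>

definition search :: "nat \<Rightarrow> (nat \<Rightarrow> com) \<Rightarrow> com" where
  "search p E = block
     [clear_prog, Const 14 0, Add 20 5 9, Store 20 8, Add 20 6 9, Store 20 14, Store 7 9,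
      Const 12 1, While_nz 12 (expand_prog p E)]"

definition peel_edge :: "nat \<Rightarrow> nat \<Rightarrow> com" where
  "peel_edge d a = (if a = d then Skip else If_nz 19 (Const 14 1) Skip)"

definition bit_prog :: "nat \<Rightarrow> com" where
  "bit_prog c = block [Add 17 17 17, Const 20 c, Add 17 17 20, Sub 20 10 17,
     If_nz 20 Skip (block [Sub 17 17 10, Sub 18 8 18])]"

fun bits_prog :: "nat \<Rightarrow> nat \<Rightarrow> com" where
  "bits_prog 0 h = Skip"
| "bits_prog (Suc j) h = Seq (bits_prog j (h div 2)) (bit_prog (h mod 2))"

text \<open>Register 20 becomes the distance of 17 from \<open>r div 2 ^ z\<close> plus the parity,
  so it vanishes iff the label is the wanted one. The comparison of low bits concerns constants and
  is settled when the program is written.\<close>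

definition check_prog :: "nat \<Rightarrow> nat \<Rightarrow> nat \<Rightarrow> com" where
  "check_prog z r a = Seq
     (if a mod 2 ^ z = r mod 2 ^ z
      then block [Const 20 (r div 2 ^ z), Sub 21 17 20, Sub 20 20 17, Add 20 20 21, Add 20 20 18]
      else Const 20 1)
     (If_nz 20 (If_nz 19 (Const 14 1) Skip) (If_nz 19 Skip (Const 14 1)))"

definition residue_edge :: "nat \<Rightarrow> nat \<Rightarrow> nat \<Rightarrow> nat \<Rightarrow> com" where
  "residue_edge p z r a = Seq (bits_prog (p - z) (a div 2 ^ z))
     (Seq (check_prog z r a) (bits_prog z (a mod 2 ^ z)))"

text \<open>The new flags go into the auxiliary array first, since the old ones are still read for
  other states.\<close>

definition pull_prog :: "nat \<Rightarrow> nat \<Rightarrow> com" where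
  "pull_prog p d = block
     [Const 20 0, Add 12 1 20,
      While_nz 12 (block
        [Sub 12 12 8, Const 20 0, Add 25 12 20, iterate p (\<lambda>_. Add 25 25 25), Add 25 25 2,
         Const 20 d, Add 25 25 20, Load 16 25, Add 20 3 16, Load 19 20, Add 20 4 12, Store 20 19])]"

definition copy_prog :: com where
  "copy_prog = block
     [Const 20 0, Add 12 1 20,
      While_nz 12 (block [Sub 12 12 8, Add 20 4 12, Load 19 20, Add 20 3 12, Store 20 19])]"

definition shift_prog :: "nat \<Rightarrow> nat \<Rightarrow> com" where
  "shift_prog p d = Seq (pull_prog p d) copy_prog"

text \<open>Counting 11 down from \<open>n - r div 2 ^ z\<close> to 1 and adding
  \<open>r div 2 ^ z\<close> makes the modulus run through all \<open>k \<le> n\<close> above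
  \<open>r div 2 ^ z\<close>.\<close>

definition test_pow :: "nat \<Rightarrow> nat \<Rightarrow> nat \<Rightarrow> com" where
  "test_pow p r z = block
     [Const 20 (r div 2 ^ z), Sub 11 1 20,
      While_nz 11 (block
        [Const 20 (r div 2 ^ z), Add 10 11 20, search p (residue_edge p z r),
         If_nz 14 Skip (Const 0 1), Sub 11 11 8])]"

definition test_prog :: "nat \<Rightarrow> nat \<Rightarrow> com" where
  "test_prog p r = Seq (Const 0 0) (iterate p (test_pow p r))"

text \<open>There are always \<open>n\<close> rounds. A round whose search fails changes no final
  flag, so all later rounds fail too.\<close>

definition strip_prog :: "nat \<Rightarrow> com" where
  "strip_prog p = block
     [Const 20 0, Add 11 1 20,
      While_nz 11 (block
        [search p (peel_edge 0), If_nz 14 Skip (shift_prog p 0), Sub 11 11 8])]"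

text \<open>The recursion on \<open>r\<close> unfolds into a finite program. For
  \<open>p = 0\<close> division by \<open>2 ^ p\<close> would not decrease \<open>r\<close>, so this
  case ends the recursion.\<close>

function solve_prog :: "nat \<Rightarrow> nat \<Rightarrow> com" where
  "solve_prog p r =
     (if p = 0 \<or> r = 0 then Seq (strip_prog p) (test_prog p 0)
      else Seq (search p (peel_edge (r mod 2 ^ p)))
        (If_nz 14 (test_prog p r)
          (Seq (shift_prog p (r mod 2 ^ p)) (solve_prog p (r div 2 ^ p)))))"
  by auto
termination by (relation "measure snd") (auto intro!: div_less_dividend one_less_power[unfolded One_nat_def])

declare solve_prog.simps [simp del]

text \<open>The input table stays in place: an undefined entry already holds the number of the sink.
  The unrolled part appends the row of the sink, backwards from the flags array; the loop copies the
  final flags behind the table.\<close>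

definition setup_prog :: "nat \<Rightarrow> com" where
  "setup_prog p = block
     [Const 8 1, Load 10 2, Load 9 8, Add 1 10 8, Add 2 1 8, Add 3 1 0,
      iterate p (\<lambda>_. Add 3 3 3), Add 3 3 2, Add 4 3 1, Add 5 4 1, Add 6 5 1, Add 7 6 1,
      iterate (2 ^ p) (\<lambda>a. block [Const 20 (Suc a), Sub 20 3 20, Store 20 10]),
      Const 20 0, Add 12 10 20,
      While_nz 12 (block [Sub 12 12 8, Const 20 2, Add 20 20 12, Load 19 20, Add 20 3 12, Store 20 19])]"

section \<open>Programs run on a single edge\<close>

lemma wp_differ_prog:
  assumes "i \<notin> {14, 23}" "j \<notin> {14, 23}"
  shows "wp (differ_prog i j) (\<lambda>t s'. t \<le> 7 \<and> mem s' = mem s \<and>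
    reg s' 14 = (if reg s i = reg s j then reg s 14 else 1) \<and>
    (\<forall>i. i \<notin> {14, 23} \<longrightarrow> reg s' i = reg s i)) s"
  \<comment> \<open>Both truncated differences vanish exactly when the numbers are equal.\<close>
  using assms by (auto simp: differ_prog_def wp_simps)

lemma wp_compare_prog:
  "wp compare_prog (\<lambda>t s'. t \<le> 17 \<and> mem s' = mem s \<and>
    reg s' 14 = (if reg s 18 = mem s (reg s 6 + reg s 16) \<and> reg s 17 = reg s 21
      then reg s 14 else 1) \<and>
    (\<forall>i. i \<notin> {14, 22, 23} \<longrightarrow> reg s' i = reg s i)) s"
  apply (simp add: compare_prog_def wp_simps split del: if_split)
  apply (rule wp_mono[OF wp_differ_prog], simp, simp)
  apply (rule wp_mono[OF wp_differ_prog], simp, simp)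
  by auto

text \<open>Cost per state: \<open>2 ^ p\<close> edges of at most \<open>12 * p + 57\<close> steps,
  \<open>p\<close> doublings for the row address, and a constant for clearing, popping and absorbed
  additive terms.\<close>

definition search_time :: "nat \<Rightarrow> nat" where
  "search_time p = (12 * p + 57) * 2 ^ p + p + 60"

text \<open>The contract of an edge program: it may change only the failure flag, the label and
  scratch registers, and it can raise the flag but never clear it.\<close>

definition edge_correct ::
  "nat \<Rightarrow> nat \<Rightarrow> (nat \<Rightarrow> com) \<Rightarrow> (nat \<Rightarrow> nat \<times> nat \<Rightarrow> nat \<times> nat) \<Rightarrow>
    (nat \<Rightarrow> nat \<times> nat \<Rightarrow> bool \<Rightarrow> bool) \<Rightarrow> bool" where
  "edge_correct p k E st chk \<longleftrightarrow>
     (\<forall>a<2 ^ p. \<forall>s. reg s 10 = k \<and> reg s 8 = 1 \<longrightarrow>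
       wp (E a) (\<lambda>t s'. t \<le> 12 * p + 12 \<and> (reg s' 17, reg s' 18) = st a (reg s 17, reg s 18) \<and>
         reg s' 14 = (if chk a (reg s 17, reg s 18) (reg s 19 \<noteq> 0) then reg s 14 else 1) \<and>
         mem s' = mem s \<and> (\<forall>i. i \<notin> {14, 17, 18, 20, 21} \<longrightarrow> reg s' i = reg s i)) s)"

lemma edge_correctD:
  assumes "edge_correct p k E st chk" "a < 2 ^ p" "reg s 10 = k" "reg s 8 = 1"
  shows "wp (E a) (\<lambda>t s'. t \<le> 12 * p + 12 \<and> (reg s' 17, reg s' 18) = st a (reg s 17, reg s 18) \<and>
    reg s' 14 = (if chk a (reg s 17, reg s 18) (reg s 19 \<noteq> 0) then reg s 14 else 1) \<and>
    mem s' = mem s \<and> (\<forall>i. i \<notin> {14, 17, 18, 20, 21} \<longrightarrow> reg s' i = reg s i)) s"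
  using assms unfolding edge_correct_def by blast

lemma peel_edge_correct:
  "edge_correct p k (peel_edge d) (\<lambda>a v. v) (\<lambda>a v f. a = d \<or> \<not> f)"
  by (auto simp: edge_correct_def peel_edge_def wp_simps)

lemma wp_bit_prog:
  assumes "reg s 10 = k" "reg s 8 = 1"
  shows "wp (bit_prog c) (\<lambda>t s'. t \<le> 12 \<and>
    (reg s' 17, reg s' 18) = bitstep k c (reg s 17, reg s 18) \<and>
    mem s' = mem s \<and> (\<forall>i. i \<notin> {17, 18, 20} \<longrightarrow> reg s' i = reg s i)) s"
  using assms by (auto simp: bit_prog_def wp_simps bitstep_def mult_2)

lemma wp_bits_prog:
  assumes "reg s 10 = k" "reg s 8 = 1"
  shows "wp (bits_prog j h) (\<lambda>t s'. t \<le> 12 * j + 1 \<and>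
    (reg s' 17, reg s' 18) = bitsteps k j h (reg s 17, reg s 18) \<and>
    mem s' = mem s \<and> (\<forall>i. i \<notin> {17, 18, 20} \<longrightarrow> reg s' i = reg s i)) s"
proof (induction j arbitrary: h)
  case 0
  then show ?case by (simp add: wp_simps)
next
  case (Suc j)
  show ?case unfolding bits_prog.simps wp_Seq
    apply (rule wp_mono[OF Suc])
    apply (rule wp_mono[OF wp_bit_prog[where k = k]])
    using assms by auto
qed

lemma wp_check_prog:
  "wp (check_prog z r a) (\<lambda>t s'. t \<le> 10 \<and>
    reg s' 14 = (if (reg s 19 \<noteq> 0) = (a mod 2 ^ z = r mod 2 ^ z \<and>
      (reg s 17, reg s 18) = (r div 2 ^ z, 0)) then reg s 14 else 1) \<and>
    mem s' = mem s \<and> (\<forall>i. i \<notin> {14, 20, 21} \<longrightarrow> reg s' i = reg s i)) s"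
  by (auto simp: check_prog_def wp_simps)

text \<open>The two runs of bits together take at most \<open>12 * p + 2\<close> steps and the check
  at most 10, which explains the bound in \<open>edge_correct\<close>.\<close>

lemma (in complete_dfa) residue_edge_correct:
  assumes "z \<le> p"
  shows "edge_correct p k (residue_edge p z r) (residue_step k z) (residue_check k z r)"
  unfolding edge_correct_def residue_edge_def wp_Seq
  apply (intro allI impI)
  apply (rule wp_mono[OF wp_bits_prog[where k = k]], simp, simp)
  apply (rule wp_mono[OF wp_check_prog])
  apply (rule wp_mono[OF wp_bits_prog[where k = k]], simp, simp)
  using assms by (auto simp: residue_step_def residue_check_def)


section \<open>Layout of the memory\<close>

context complete_dfa
begin

text \<open>For an input automaton with \<open>N\<close> states \<open>n\<close> is
  \<open>N + 1\<close>, so \<open>n + 1\<close> counts the words before the input table: two numbers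
  and \<open>N\<close> flags.\<close>

definition cell :: "nat \<Rightarrow> nat \<Rightarrow> nat" where
  "cell q a = n + 1 + q * b + a"

text \<open>Arrays of length \<open>n\<close> behind the table: 0 final flags, 1 auxiliary, 2
  residues plus one, 3 parities, 4 stack.\<close>

definition adr :: "nat \<Rightarrow> nat \<Rightarrow> nat" where
  "adr j q = cell n 0 + j * n + q"

definition env :: "state \<Rightarrow> bool" where
  "env s \<longleftrightarrow> reg s 1 = n \<and> reg s 2 = cell 0 0 \<and> reg s 3 = adr 0 0 \<and> reg s 4 = adr 1 0 \<and>
     reg s 5 = adr 2 0 \<and> reg s 6 = adr 3 0 \<and> reg s 7 = adr 4 0 \<and> reg s 8 = 1 \<and> reg s 9 = q0 \<and>
     (\<forall>q<n. \<forall>a<b. mem s (cell q a) = \<delta> q a)"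

definition flags :: "nat set \<Rightarrow> state \<Rightarrow> bool" where
  "flags F s \<longleftrightarrow> (\<forall>q<n. mem s (adr 0 q) = of_bool (q \<in> F))"

definition same_regs :: "state \<Rightarrow> state \<Rightarrow> bool" where
  "same_regs s s' \<longleftrightarrow> (\<forall>i<12. reg s' i = reg s i)"

lemma adr_add: "adr j 0 + q = adr j q"
  by (simp add: adr_def)

lemma cell_add: "cell q 0 + a = cell q a" "q * b + cell 0 0 = cell q 0"
  by (simp_all add: cell_def)

lemma adr_eq_iff: "q < n \<Longrightarrow> q' < n \<Longrightarrow> adr j q = adr j' q' \<longleftrightarrow> j = j' \<and> q = q'"
proof -
  assume q: "q < n" "q' < n"
  have "j = j'" if "j * n + q = j' * n + q'"
  proof -
    have "(q + j * n) div n = (q' + j' * n) div n" using that by (simp add: add.commute)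
    then show ?thesis using q by simp
  qed
  then show ?thesis by (auto simp: adr_def)
qed

lemma cell_neq_adr: "q < n \<Longrightarrow> a < b \<Longrightarrow> cell q a \<noteq> adr j q'"
proof -
  assume "q < n" "a < b"
  then have "q * b + a < Suc q * b" "Suc q * b \<le> n * b"
    using mult_le_mono1[of "Suc q" n b] by simp_all
  then have "q * b + a < n * b" by linarith
  then show ?thesis by (simp add: cell_def adr_def)
qed

lemmas adr_simps = adr_add cell_add adr_eq_iff cell_neq_adr cell_neq_adr[symmetric]

type_synonym search_state = "nat list \<times> (nat \<Rightarrow> (nat \<times> nat) option) \<times> bool"

text \<open>Parities are constrained for labelled states alone, so clearing array 2 suffices before
  a search.\<close>

definition stored :: "search_state \<Rightarrow> state \<Rightarrow> bool" where
  "stored \<sigma> s \<longleftrightarrow> (case \<sigma> of (xs, \<phi>, f) \<Rightarrow>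
     reg s 12 = length xs \<and> reg s 14 = of_bool f \<and>
     (\<forall>i<length xs. mem s (adr 4 i) = xs ! i) \<and>
     (\<forall>q<n. mem s (adr 2 q) = (case \<phi> q of None \<Rightarrow> 0 | Some v \<Rightarrow> Suc (fst v))) \<and>
     (\<forall>q<n. \<forall>v. \<phi> q = Some v \<longrightarrow> mem s (adr 3 q) = snd v))"

end

section \<open>The search on abstract states\<close>

locale dfa_search = complete_dfa +
  fixes F :: "nat set" and st :: "nat \<Rightarrow> nat \<times> nat \<Rightarrow> nat \<times> nat"
    and chk :: "nat \<Rightarrow> nat \<times> nat \<Rightarrow> bool \<Rightarrow> bool"
begin

abbreviation "label u \<equiv> foldl (\<lambda>v a. st a v) (0, 0) u"

definition traverse :: "nat \<Rightarrow> nat \<Rightarrow> search_state \<Rightarrow> search_state" where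
  "traverse q a \<sigma> = (case \<sigma> of (xs, \<phi>, f) \<Rightarrow>
     let v = st a (the (\<phi> q)); q' = \<delta> q a; f' = (f \<or> \<not> chk a (the (\<phi> q)) (q' \<in> F))
     in case \<phi> q' of
          None \<Rightarrow> (xs @ [q'], \<phi>(q' \<mapsto> v), f')
        | Some w \<Rightarrow> (xs, \<phi>, f' \<or> w \<noteq> v))"

text \<open>
  All edges of the discovered states that are not on the stack have been traversed, but of the state
  \<open>c\<close>, which is being expanded, only those with letters below \<open>j\<close>.
\<close>

definition explored :: "nat \<Rightarrow> nat \<Rightarrow> search_state \<Rightarrow> bool" where
  "explored c j \<sigma> \<longleftrightarrow> (case \<sigma> of (xs, \<phi>, f) \<Rightarrow>
     \<phi> q0 = Some (0, 0) \<and> (\<forall>q v. \<phi> q = Some v \<longrightarrow> (\<exists>u\<in>words. reach u = q \<and> label u = v)) \<and>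
     distinct xs \<and> set xs \<subseteq> dom \<phi> \<and> (f \<longrightarrow> \<not> consistent F st chk (0, 0)) \<and>
     (\<not> f \<longrightarrow> (\<forall>q\<in>dom \<phi> - set xs. \<forall>a<b. (q = c \<longrightarrow> a < j) \<longrightarrow>
        \<phi> (\<delta> q a) = Some (st a (the (\<phi> q))) \<and> chk a (the (\<phi> q)) (\<delta> q a \<in> F))))"

text \<open>Bounds the remaining pops: stack entries plus undiscovered states. A push keeps it, a
  pop lowers it by one.\<close>

definition potential :: "search_state \<Rightarrow> nat" where
  "potential \<sigma> = (case \<sigma> of (xs, \<phi>, f) \<Rightarrow> length xs + (n - card (dom \<phi>)))"

lemma explored_dom: "explored c j (xs, \<phi>, f) \<Longrightarrow> dom \<phi> \<subseteq> {..<n}"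
  using reach_less unfolding explored_def dom_def by blast

lemma explored_length:
  assumes "explored c j (xs, \<phi>, f)"
  shows "length xs \<le> card (dom \<phi>)" "card (dom \<phi>) \<le> n"
proof -
  have fin: "finite (dom \<phi>)" using explored_dom[OF assms] by (rule finite_subset) simp
  have "distinct xs" "set xs \<subseteq> dom \<phi>" using assms unfolding explored_def by auto
  then show "length xs \<le> card (dom \<phi>)" using card_mono[OF fin, of "set xs"] distinct_card[of xs] by simp
  show "card (dom \<phi>) \<le> n" using card_mono[of "{..<n}" "dom \<phi>"] explored_dom[OF assms] by simp
qed

lemma explored_pop: "explored n b (xs @ [q], \<phi>, f) \<Longrightarrow> explored q 0 (xs, \<phi>, f)"
  unfolding explored_def by auto

text \<open>When \<open>j\<close> is \<open>b\<close> the restriction on \<open>c\<close> is void,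
  so \<open>c\<close> may become \<open>n\<close>, which is not a state.\<close>

lemma explored_finish: "explored c b \<sigma> \<Longrightarrow> explored n b \<sigma>"
  unfolding explored_def by (auto split: prod.splits)

text \<open>If the flag is raised, the words behind the labels refute consistency; otherwise the
  edge with letter \<open>j\<close> joins the checked ones.\<close>

lemma explored_traverse:
  assumes ex: "explored c j (xs, \<phi>, f)" and c: "c \<in> dom \<phi> - set xs" and j: "j < b"
    and tr: "traverse c j (xs, \<phi>, f) = (xs', \<phi>', f')"
  shows "explored c (Suc j) (xs', \<phi>', f')" "c \<in> dom \<phi>' - set xs'"
    "potential (xs', \<phi>', f') = potential (xs, \<phi>, f)"
proof -
  obtain v where v: "\<phi> c = Some v" using c by blast
  obtain u where u: "u \<in> words" "reach u = c" "label u = v"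
    using ex v unfolding explored_def by blast
  define q' where "q' = \<delta> c j"
  have uj: "u @ [j] \<in> words" "reach (u @ [j]) = q'" "label (u @ [j]) = st j v"
    using u j by (simp_all add: q'_def)
  have chk: "chk j v (q' \<in> F)" if "consistent F st chk (0, 0)"
    using that u j unfolding consistent_def q'_def by blast
  \<comment> \<open>The old label of the target comes from some word \<open>u'\<close>, which
    reaches the same state as \<open>u @ [j]\<close>.\<close>
  have con: "w = st j v" if cs: "consistent F st chk (0, 0)" and w: "\<phi> q' = Some w" for w
  proof -
    obtain u' where u': "u' \<in> words" "reach u' = q'" "label u' = w"
      using ex w unfolding explored_def by blast
    have "label u' = label (u @ [j])"
      using cs u'(1,2) uj(1,2) unfolding consistent_def by (metis (no_types))
    then show ?thesis using u' uj by simp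
  qed
  have old: "\<phi> (\<delta> q a) = Some (st a (the (\<phi> q))) \<and> chk a (the (\<phi> q)) (\<delta> q a \<in> F)"
    if "\<not> f" "q \<in> dom \<phi> - set xs" "a < b" "q = c \<longrightarrow> a < j" for q a
    using ex that unfolding explored_def by blast
  have sub: "set xs \<subseteq> dom \<phi>" using ex unfolding explored_def by blast
  have "explored c (Suc j) (xs', \<phi>', f') \<and> c \<in> dom \<phi>' - set xs' \<and>
    potential (xs', \<phi>', f') = potential (xs, \<phi>, f)"
  proof (cases "\<phi> q'")
    case (Some w)
    then have eq: "xs' = xs" "\<phi>' = \<phi>" "f' = (f \<or> \<not> chk j v (q' \<in> F) \<or> w \<noteq> st j v)"
      using tr v by (auto simp: traverse_def Let_def q'_def)
    have "explored c (Suc j) (xs, \<phi>, f')"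
      unfolding explored_def prod.case
    proof (intro conjI allI impI ballI)
      show "\<phi> q0 = Some (0, 0)" "distinct xs" "set xs \<subseteq> dom \<phi>"
        using ex unfolding explored_def by auto
      show "\<exists>u\<in>words. reach u = q \<and> label u = w" if "\<phi> q = Some w" for q w
        using that ex unfolding explored_def by blast
      show "\<not> consistent F st chk (0, 0)" if f'
        using that ex chk con[OF _ Some] unfolding explored_def eq(3) by blast
      fix q a assume qa: "\<not> f'" "q \<in> dom \<phi> - set xs" "a < b" "q = c \<longrightarrow> a < Suc j"
      show "\<phi> (\<delta> q a) = Some (st a (the (\<phi> q)))"
        using old[of q a] qa v Some q'_def eq(3) by (cases "q = c \<and> a = j") auto
      show "chk a (the (\<phi> q)) (\<delta> q a \<in> F)"
        using old[of q a] qa v q'_def eq(3) by (cases "q = c \<and> a = j") auto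
    qed
    then show ?thesis using c eq by (simp add: potential_def)
  next
    case None
    then have eq: "xs' = xs @ [q']" "\<phi>' = \<phi>(q' \<mapsto> st j v)" "f' = (f \<or> \<not> chk j v (q' \<in> F))"
      using tr v by (auto simp: traverse_def Let_def q'_def)
    have qc: "q' \<noteq> c" "q' \<notin> set xs" using None v sub by auto
    have ex': "explored c (Suc j) (xs @ [q'], \<phi>(q' \<mapsto> st j v), f')"
      unfolding explored_def prod.case
    proof (intro conjI allI impI ballI)
      show "(\<phi>(q' \<mapsto> st j v)) q0 = Some (0, 0)" "distinct (xs @ [q'])"
        "set (xs @ [q']) \<subseteq> dom (\<phi>(q' \<mapsto> st j v))"
        using ex qc None unfolding explored_def by auto
      show "\<not> consistent F st chk (0, 0)" if f'
        using that ex chk unfolding explored_def eq(3) by blast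
      show "\<exists>u\<in>words. reach u = q \<and> label u = w" if "(\<phi>(q' \<mapsto> st j v)) q = Some w" for q w
      proof (cases "q = q'")
        case True
        then show ?thesis using that uj by (intro bexI[of _ "u @ [j]"]) auto
      next
        case False
        then have "\<phi> q = Some w" using that by simp
        then show ?thesis using ex unfolding explored_def by blast
      qed
      fix q a assume qa: "\<not> f'" "q \<in> dom (\<phi>(q' \<mapsto> st j v)) - set (xs @ [q'])" "a < b"
        "q = c \<longrightarrow> a < Suc j"
      then have q: "q \<noteq> q'" "q \<in> dom \<phi> - set xs" "\<not> f" by (auto simp: eq(3))
      show "(\<phi>(q' \<mapsto> st j v)) (\<delta> q a) = Some (st a (the ((\<phi>(q' \<mapsto> st j v)) q)))"
      proof (cases "q = c \<and> a = j")
        case True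
        then show ?thesis using v qc by (simp flip: q'_def)
      next
        case False
        then have o: "\<phi> (\<delta> q a) = Some (st a (the (\<phi> q)))" using old[of q a] q qa by auto
        \<comment> \<open>A checked edge leads to a labelled state, hence not to the new
          \<open>q'\<close>, so the update leaves it intact.\<close>
        then have "\<delta> q a \<noteq> q'" using None by auto
        then show ?thesis using o q by simp
      qed
      show "chk a (the ((\<phi>(q' \<mapsto> st j v)) q)) (\<delta> q a \<in> F)"
      proof (cases "q = c \<and> a = j")
        case True
        then show ?thesis using v qc qa(1) by (simp add: eq(3) flip: q'_def)
      next
        case False
        then show ?thesis using old[of q a] q qa by auto
      qed
    qed
    have "card (dom (\<phi>(q' \<mapsto> st j v))) = Suc (card (dom \<phi>))"
    proof -
      have "finite (dom \<phi>)" using explored_dom[OF ex] by (rule finite_subset) simp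
      then show ?thesis using None by (simp add: domIff)
    qed
    \<comment> \<open>The bound by \<open>n\<close> keeps the truncated subtraction in
      \<open>potential\<close> exact, so the longer stack is balanced.\<close>
    moreover have "card (dom (\<phi>(q' \<mapsto> st j v))) \<le> n" by (rule explored_length(2)[OF ex'])
    ultimately show ?thesis using ex' qc c unfolding eq(1,2) potential_def by auto
  qed
  then show "explored c (Suc j) (xs', \<phi>', f')" "c \<in> dom \<phi>' - set xs'"
    "potential (xs', \<phi>', f') = potential (xs, \<phi>, f)" by blast+
qed

lemma explored_start: "explored n b ([q0], [q0 \<mapsto> (0, 0)], False)"
  unfolding explored_def by (auto intro!: bexI[of _ "[]"] split: if_splits)

text \<open>With an empty stack and no failure the labelled states are closed under transitions, so
  by induction every word carries the label stored at its state.\<close>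

lemma explored_end:
  assumes "explored n b ([], \<phi>, f)"
  shows "f \<longleftrightarrow> \<not> consistent F st chk (0, 0)"
proof (cases f)
  case False
  have closed: "\<phi> (\<delta> q a) = Some (st a (the (\<phi> q))) \<and> chk a (the (\<phi> q)) (\<delta> q a \<in> F)"
    if "q \<in> dom \<phi>" "a < b" for q a
    using assms False that unfolding explored_def by auto
  have lab: "\<phi> (reach u) = Some (label u)" if "u \<in> words" for u
    using that
  proof (induction u rule: rev_induct)
    case Nil
    then show ?case using assms by (simp add: explored_def)
  next
    case (snoc a u)
    then show ?case using closed[of "reach u" a] by (auto simp: dom_def)
  qed
  have "consistent F st chk (0, 0)"
    unfolding consistent_def
  proof (intro conjI ballI allI impI)
    show "label u = label u'" if "u \<in> words" "u' \<in> words" "reach u = reach u'" for u u'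
      using lab that by (metis option.inject)
    show "chk a (label u) (\<delta> (reach u) a \<in> F)" if "u \<in> words" "a < b" for u a
      using closed[of "reach u" a] lab that by auto
  qed
  then show ?thesis using False by simp
qed (use assms in \<open>simp add: explored_def\<close>)

end

section \<open>Correctness and running time\<close>

declare split_paired_All [simp del] split_paired_Ex [simp del]

context complete_dfa
begin

lemma env_cong:
  assumes "env s" "\<And>i. 0 < i \<Longrightarrow> i < 10 \<Longrightarrow> reg s' i = reg s i"
    "\<And>q a. q < n \<Longrightarrow> a < b \<Longrightarrow> mem s' (cell q a) = mem s (cell q a)"
  shows "env s'"
  using assms unfolding env_def by simp

lemma env_n: "env s \<Longrightarrow> reg s (Suc 0) = n"
  by (simp add: env_def)

lemma flags_cong:
  assumes "flags F s" "\<And>q. q < n \<Longrightarrow> mem s' (adr 0 q) = mem s (adr 0 q)"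
  shows "flags F s'"
  using assms unfolding flags_def by simp

text \<open>As \<open>n\<close> is positive, additive constants are absorbed into a multiple of
  \<open>n\<close>.\<close>

lemma time_le_mult_n: "t \<le> c * n + d \<Longrightarrow> t \<le> (c + d) * n"
proof -
  assume t: "t \<le> c * n + d"
  have "d * 1 \<le> d * n" using n_pos by (intro mult_le_mono2) simp
  with t show ?thesis unfolding add_mult_distrib by linarith
qed

end

section \<open>The search program refines the abstract search\<close>

context dfa_search
begin

text \<open>Refines \<open>traverse\<close>. The condition on \<open>length xs\<close> keeps a
  pushed entry inside the stack array, whose addresses \<open>adr_eq_iff\<close> separates from the
  others.\<close>

lemma wp_visit_edge:
  assumes E: "edge_correct p k E st chk"
    and s: "env s" "flags F s" "stored (xs, \<phi>, f) s" "reg s 10 = k" "reg s 15 = q"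
      "reg s 25 = cell q 0"
    and q: "q < n" "\<phi> q = Some v" "a < b" "\<phi> (\<delta> q a) = None \<Longrightarrow> length xs < n"
  shows "wp (visit_edge E a) (\<lambda>t s'. t \<le> 12 * p + 57 \<and> env s' \<and> flags F s' \<and>
    stored (traverse q a (xs, \<phi>, f)) s' \<and> reg s' 15 = q \<and> reg s' 25 = cell q 0 \<and>
    same_regs s s') s"
proof -
  define q' where "q' = \<delta> q a"
  have q': "q' < n" using q \<delta>_less by (simp add: q'_def)
  have regs: "reg s 3 = adr 0 0" "reg s 5 = adr 2 0" "reg s 6 = adr 3 0" "reg s 7 = adr 4 0"
    "reg s 8 = 1" "mem s (cell q a) = q'" using s(1) q by (auto simp: env_def q'_def)
  have vals: "mem s (adr 2 q) = Suc (fst v)" "mem s (adr 3 q) = snd v"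
    "mem s (adr 0 q') = of_bool (q' \<in> F)" "reg s 12 = length xs" "reg s 14 = of_bool f"
    using s(2,3) q q' unfolding stored_def flags_def by (simp_all del: split_paired_All)
  have 1: "wp (block [Const 20 a, Add 20 25 20, Load 16 20, Add 20 5 15, Load 17 20, Sub 17 17 8,
        Add 20 6 15, Load 18 20, Add 20 3 16, Load 19 20])
      (\<lambda>t s1. t \<le> 11 \<and> mem s1 = mem s \<and> reg s1 16 = q' \<and> reg s1 17 = fst v \<and>
        reg s1 18 = snd v \<and> reg s1 19 = of_bool (q' \<in> F) \<and>
        (\<forall>i. i \<notin> {16, 17, 18, 19, 20} \<longrightarrow> reg s1 i = reg s i)) s"
    by (simp add: wp_simps regs s vals adr_simps)
  obtain s' p' where sp: "st a v = (s', p')" by (cases "st a v")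
  define f' where "f' = (f \<or> \<not> chk a v (q' \<in> F))"
  show ?thesis unfolding visit_edge_def wp_Seq
  proof (rule wp_mono[OF 1], rule wp_mono[OF edge_correctD[OF E q(3)]])
    fix t1 t2 :: nat and s1 s2 :: state
    assume s1: "t1 \<le> 11 \<and> mem s1 = mem s \<and> reg s1 16 = q' \<and> reg s1 17 = fst v \<and>
        reg s1 18 = snd v \<and> reg s1 19 = of_bool (q' \<in> F) \<and>
        (\<forall>i. i \<notin> {16, 17, 18, 19, 20} \<longrightarrow> reg s1 i = reg s i)"
    show "reg s1 10 = k" "reg s1 8 = 1" using s1 s regs by auto
    assume s2: "t2 \<le> 12 * p + 12 \<and> (reg s2 17, reg s2 18) = st a (reg s1 17, reg s1 18) \<and>
        reg s2 14 = (if chk a (reg s1 17, reg s1 18) (reg s1 19 \<noteq> 0) then reg s1 14 else 1) \<and>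
        mem s2 = mem s1 \<and> (\<forall>i. i \<notin> {14, 17, 18, 20, 21} \<longrightarrow> reg s2 i = reg s1 i)"
    have keep: "reg s2 i = reg s i" if "i \<notin> {14, 16, 17, 18, 19, 20, 21}" for i
      using s1 s2 that by simp
    have mem2: "mem s2 = mem s" using s1 s2 by simp
    have r2: "reg s2 17 = s'" "reg s2 18 = p'" "reg s2 14 = of_bool f'" "reg s2 16 = q'"
      using s1 s2 sp vals by (auto simp: f'_def)
    have k2: "reg s2 5 = adr 2 0" "reg s2 6 = adr 3 0" "reg s2 7 = adr 4 0" "reg s2 8 = 1"
        "reg s2 12 = length xs" "reg s2 15 = q" "reg s2 25 = cell q 0"
      using keep regs vals s by auto
    have same2: "reg s2 i = reg s i" if "i < 12" for i
      using keep that by simp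
    have env2: "env s2" "flags F s2"
      using s(1,2) same2 mem2 by (auto simp: env_def flags_def)
    have st2: "\<forall>i<length xs. mem s2 (adr 4 i) = xs ! i"
      "\<forall>q<n. mem s2 (adr 2 q) = (case \<phi> q of None \<Rightarrow> 0 | Some v \<Rightarrow> Suc (fst v))"
      "\<forall>q<n. \<forall>v. \<phi> q = Some v \<longrightarrow> mem s2 (adr 3 q) = snd v"
      using s(3) mem2 by (auto simp: stored_def)
    show "wp (block [Add 17 17 8, Add 20 5 16, Load 21 20,
        If_nz 21
          compare_prog
          (block [Store 20 17, Add 20 6 16, Store 20 18, Add 20 7 12, Store 20 16, Add 12 12 8])])
      (\<lambda>t s'. t1 + (t2 + t) \<le> 12 * p + 57 \<and> env s' \<and> flags F s' \<and>
        stored (traverse q a (xs, \<phi>, f)) s' \<and> reg s' 15 = q \<and> reg s' 25 = cell q 0 \<and>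
        same_regs s s') s2"
    proof (cases "\<phi> q'")
      case (Some w)
      have tr: "traverse q a (xs, \<phi>, f) = (xs, \<phi>, f' \<or> w \<noteq> (s', p'))"
        using Some q(2) sp by (simp add: traverse_def Let_def f'_def flip: q'_def)
      have m: "mem s2 (adr 2 q') = Suc (fst w)" "mem s2 (adr 3 q') = snd w"
        using st2 q' Some by auto
      have t: "t1 \<le> 11" "t2 \<le> 12 * p + 12" using s1 s2 by auto
      show ?thesis unfolding tr
        apply (simp add: wp_simps k2 r2 adr_simps m)
        apply (rule wp_mono[OF wp_compare_prog])
        using t st2 by (auto simp: stored_def same_regs_def same2 k2 r2 m adr_simps prod_eq_iff
            intro!: env_cong[OF env2(1)] flags_cong[OF env2(2)])
    next
      case None
      have tr: "traverse q a (xs, \<phi>, f) = (xs @ [q'], \<phi>(q' \<mapsto> (s', p')), f')"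
        using None q(2) sp by (simp add: traverse_def Let_def f'_def flip: q'_def)
      have m: "mem s2 (adr 2 q') = 0" using st2 q' None by auto
      have len: "length xs < n" using None q(4) by (simp add: q'_def)
      have t: "t1 \<le> 11" "t2 \<le> 12 * p + 12" using s1 s2 by auto
      show ?thesis unfolding tr
        apply (simp add: wp_simps k2 r2 adr_simps m)
        using t st2 q' len apply (auto simp: stored_def same_regs_def same2 k2 r2 adr_simps nth_append less_Suc_eq intro!: env_cong[OF env2(1)] flags_cong[OF env2(2)])
        done
    qed
  qed
qed

lemma wp_expand_prog:
  assumes E: "edge_correct p k E st chk"
    and s: "env s" "flags F s" "stored \<sigma> s" "reg s 10 = k" "explored c b \<sigma>" "reg s 12 \<noteq> 0"
  shows "wp (expand_prog p E) (\<lambda>t s'. t \<le> (12 * p + 57) * b + p + 12 \<and>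
    (\<exists>\<sigma>' c'. env s' \<and> flags F s' \<and> stored \<sigma>' s' \<and> same_regs s s' \<and> explored c' b \<sigma>' \<and>
      Suc (potential \<sigma>') = potential \<sigma>)) s"
proof -
  obtain xs0 \<phi> f where \<sigma>: "\<sigma> = (xs0, \<phi>, f)" by (cases \<sigma>) auto
  have "xs0 \<noteq> []" using s(3,6) by (auto simp: \<sigma> stored_def)
  then obtain xs q where xs0: "xs0 = xs @ [q]" by (cases xs0 rule: rev_cases) auto
  have ex: "explored q 0 (xs, \<phi>, f)" using explored_pop[of xs q \<phi> f] s(5)
    by (auto simp: \<sigma> xs0 explored_def)
  have q: "q \<in> dom \<phi> - set xs" using s(5) by (auto simp: \<sigma> xs0 explored_def)
  then have qn: "q < n" using explored_dom[OF ex] by auto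
  have pot: "Suc (potential (xs, \<phi>, f)) = potential \<sigma>" by (simp add: \<sigma> xs0 potential_def)
  define I where "I j s' \<longleftrightarrow> env s' \<and> flags F s' \<and> same_regs s s' \<and> reg s' 15 = q \<and>
      reg s' 25 = cell q 0 \<and> (\<exists>xs \<phi> f. stored (xs, \<phi>, f) s' \<and> explored q j (xs, \<phi>, f) \<and>
        q \<in> dom \<phi> - set xs \<and> Suc (potential (xs, \<phi>, f)) = potential \<sigma>)" for j s'
  have len: "length xs \<le> n" using explored_length[OF ex] by simp
  have step: "wp (visit_edge E j) (\<lambda>t s''. t \<le> 12 * p + 57 \<and> I (Suc j) s'') s'"
    if j: "j < b" and I: "I j s'" for j s'
  proof -
    obtain xs \<phi> f where x: "stored (xs, \<phi>, f) s'" "explored q j (xs, \<phi>, f)"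
        "q \<in> dom \<phi> - set xs" "Suc (potential (xs, \<phi>, f)) = potential \<sigma>"
      using I unfolding I_def by blast
    obtain v where v: "\<phi> q = Some v" using x by auto
    obtain xs' \<phi>' f' where tr: "traverse q j (xs, \<phi>, f) = (xs', \<phi>', f')"
      by (cases "traverse q j (xs, \<phi>, f)") auto
    note t = explored_traverse[OF x(2,3) j tr]
    \<comment> \<open>The state being expanded is labelled but not on the stack, so the stack is a
      proper part of the labelled states.\<close>
    have "length xs < n"
    proof -
      have "card (set xs) < card (dom \<phi>)"
        using x(2,3) finite_subset[OF explored_dom[OF x(2)]]
        by (intro psubset_card_mono) (auto simp: explored_def)
      moreover have "distinct xs" using x(2) by (simp add: explored_def)
      ultimately show ?thesis using explored_length(2)[OF x(2)] by (simp add: distinct_card)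
    qed
    moreover have "reg s' 10 = k" using I s(4) by (simp add: I_def same_regs_def)
    ultimately show ?thesis
      using wp_visit_edge[OF E _ _ x(1) _ _ _ qn v j] I unfolding I_def tr
      by (elim conjE) (rule wp_mono, blast, use t x(4) in
          \<open>auto simp: same_regs_def intro!: exI[of _ xs'] exI[of _ \<phi>'] exI[of _ f']\<close>)
  qed
  have "mem s (adr 4 (length xs)) = q" using s(3) by (simp add: \<sigma> xs0 stored_def)
  then have start: "I 0 s'" if "mem s' = mem s" "\<forall>i<12. reg s' i = reg s i"
      "reg s' 12 = length xs" "reg s' 14 = reg s 14" "reg s' 15 = q" "reg s' 25 = cell q 0" for s'
  proof -
    have "env s'" by (rule env_cong[OF s(1)]) (use that in auto)
    moreover have "flags F s'" by (rule flags_cong[OF s(2)]) (use that in auto)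
    moreover have "stored (xs, \<phi>, f) s'"
      using s(3) that by (auto simp: stored_def \<sigma> xs0 nth_append)
    ultimately show ?thesis
      unfolding I_def same_regs_def using that ex q pot by blast
  qed
  have regs: "reg s 7 = adr 4 0" "reg s 8 = 1" "reg s 2 = cell 0 0" "reg s 12 = Suc (length xs)"
    using s(1,3) by (auto simp: env_def stored_def \<sigma> xs0)
  show ?thesis unfolding expand_prog_def
    apply (simp add: wp_simps regs adr_simps \<open>mem s (adr 4 (length xs)) = q\<close>)
    apply (rule wp_mono[OF wp_doubling])
    apply (clarsimp simp: wp_simps)
    apply (rule wp_mono[OF wp_iterate[where I = I and K = "12 * p + 57"]])
      apply (erule (1) step)
     apply (rule start; simp add: regs adr_simps)
    using explored_finish unfolding I_def by (auto simp: mult.commute)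
qed

lemma wp_clear_prog:
  assumes "env s" "flags F s"
  shows "wp clear_prog (\<lambda>t s'. t \<le> 7 * n + 4 \<and> env s' \<and> flags F s' \<and> same_regs s s' \<and>
    (\<forall>q<n. mem s' (adr 2 q) = 0)) s"
proof -
  define I where "I m s' \<longleftrightarrow> env s' \<and> flags F s' \<and> same_regs s s' \<and> reg s' 12 = m \<and> m \<le> n \<and>
    (\<forall>q. m \<le> q \<and> q < n \<longrightarrow> mem s' (adr 2 q) = 0)" for m s'
  have "wp (block [Sub 12 12 8, Add 20 5 12, Const 21 0, Store 20 21])
      (\<lambda>t s''. t \<le> 5 \<and> I m s'') s'" if "I (Suc m) s'" for m s'
  proof -
    have I: "env s'" "flags F s'" "same_regs s s'" "reg s' 12 = Suc m" "m < n"
      "\<And>q. m < q \<Longrightarrow> q < n \<Longrightarrow> mem s' (adr 2 q) = 0"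
      using that by (auto simp: I_def Suc_le_eq)
    have "reg s' 5 = adr 2 0" "reg s' 8 = 1" using I(1) by (auto simp: env_def)
    then show ?thesis using I(3-6)
      by (auto simp: I_def wp_simps adr_simps same_regs_def le_less
          intro!: env_cong[OF I(1)] flags_cong[OF I(2)])
  qed
  note loop = wp_for[where I = I and K = 5 and i = 12, OF this]
  show ?thesis unfolding clear_prog_def
    apply (simp add: wp_simps)
    apply (rule wp_mono[OF loop[where m = n]])
      apply (simp add: I_def)
     apply (auto simp: I_def same_regs_def env_n[OF assms(1)] intro!: env_cong[OF assms(1)] flags_cong[OF assms(2)])
    done
qed

text \<open>The potential starts at \<open>n\<close> and falls with each expansion, so there are at
  most \<open>n\<close> expansions, each of a cost independent of \<open>n\<close>.\<close>

lemma wp_search: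
  assumes E: "edge_correct p k E st chk" and s: "env s" "flags F s" "reg s 10 = k"
  shows "wp (search p E) (\<lambda>t s'. t \<le> search_time p * n \<and> env s' \<and> flags F s' \<and> same_regs s s' \<and>
    reg s' 14 = of_bool (\<not> consistent F st chk (0, 0))) s"
proof -
  define T where "T = (12 * p + 57) * b + p + 12"
  define I where "I m s' \<longleftrightarrow> (\<exists>\<sigma> c. env s' \<and> flags F s' \<and> same_regs s s' \<and> stored \<sigma> s' \<and>
    explored c b \<sigma> \<and> potential \<sigma> = m)" for m s'
  have "wp (expand_prog p E) (\<lambda>t s''. t \<le> T \<and> (\<exists>m'<m. I m' s'')) s'"
    if I: "I m s'" "reg s' 12 \<noteq> 0" for m s'
  proof -
    obtain \<sigma> c where \<sigma>: "env s'" "flags F s'" "same_regs s s'" "stored \<sigma> s'" "explored c b \<sigma>"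
        "potential \<sigma> = m"
      using I unfolding I_def by blast
    have "reg s' 10 = k" using \<sigma>(3) s(3) by (simp add: same_regs_def)
    show ?thesis
    proof (rule wp_mono[OF wp_expand_prog[OF E \<sigma>(1,2,4) \<open>reg s' 10 = k\<close> \<sigma>(5) I(2)]])
      fix t s''
      assume "t \<le> (12 * p + 57) * b + p + 12 \<and> (\<exists>\<sigma>' c'. env s'' \<and> flags F s'' \<and> stored \<sigma>' s'' \<and>
        same_regs s' s'' \<and> explored c' b \<sigma>' \<and> Suc (potential \<sigma>') = potential \<sigma>)"
      then obtain \<sigma>' c' where "t \<le> T" "env s''" "flags F s''" "stored \<sigma>' s''"
        "same_regs s' s''" "explored c' b \<sigma>'" "Suc (potential \<sigma>') = potential \<sigma>"
        unfolding T_def by blast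
      moreover from this have "same_regs s s''" using \<sigma>(3) by (simp add: same_regs_def)
      ultimately show "t \<le> T \<and> (\<exists>m'<m. I m' s'')"
        using \<sigma>(6) unfolding I_def
          by (intro conjI exI[of _ "potential \<sigma>'"] exI[of _ \<sigma>'] exI[of _ c']) auto
    qed
  qed
  note loop = wp_while[where I = I and K = T, OF this]
  show ?thesis unfolding search_def wp_block(2)[of clear_prog]
  proof (rule wp_mono[OF wp_clear_prog[OF s(1,2)]])
    fix t1 s1
    assume s1: "t1 \<le> 7 * n + 4 \<and> env s1 \<and> flags F s1 \<and> same_regs s s1 \<and>
      (\<forall>q<n. mem s1 (adr 2 q) = 0)"
    then have regs: "reg s1 5 = adr 2 0" "reg s1 6 = adr 3 0" "reg s1 7 = adr 4 0" "reg s1 8 = 1"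
      "reg s1 9 = q0" by (auto simp: env_def)
    define w :: nat where "w = of_bool (\<not> consistent F st chk (0, 0))"
    have start: "I n s2" if "reg s2 12 = 1" "reg s2 14 = 0" "\<forall>i<12. reg s2 i = reg s1 i"
      "mem s2 = (mem s1)(adr 2 q0 := 1, adr 3 q0 := 0, adr 4 0 := q0)" for s2
      unfolding I_def
    proof (intro exI conjI)
      show "explored 0 b ([q0], [q0 \<mapsto> (0, 0)], False)"
        using explored_start explored_def by auto
      show "env s2" "flags F s2" "same_regs s s2"
        using that s1 n_pos q0_less by (auto simp: env_def flags_def same_regs_def adr_simps)
      show "stored ([q0], [q0 \<mapsto> (0, 0)], False) s2"
        using that s1 n_pos q0_less by (auto simp: stored_def adr_simps)
      show "potential ([q0], [q0 \<mapsto> (0, 0)], False) = n"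
        using n_pos by (simp add: potential_def)
    qed
    show "wp (block [Const 14 0, Add 20 5 9, Store 20 8, Add 20 6 9, Store 20 14, Store 7 9,
          Const 12 1, While_nz 12 (expand_prog p E)])
        (\<lambda>t s'. t1 + t \<le> search_time p * n \<and> env s' \<and> flags F s' \<and> same_regs s s' \<and>
          reg s' 14 = of_bool (\<not> consistent F st chk (0, 0))) s1"
      unfolding w_def[symmetric]
      apply (simp add: wp_simps regs adr_simps)
      apply (rule wp_mono[OF loop[where m = n]], assumption, assumption)
       apply (rule start; simp)
    proof -
      fix t s' assume "t \<le> Suc T * n + 1 \<and> (\<exists>m'. I m' s') \<and> reg s' 12 = 0"
      then obtain xs \<phi> f c where x: "env s'" "flags F s'" "same_regs s s'" "stored (xs, \<phi>, f) s'"
        "explored c b (xs, \<phi>, f)" "t \<le> Suc T * n + 1" "reg s' 12 = 0"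
        unfolding I_def by auto
      have "xs = []" using x by (simp add: stored_def)
      then have "f \<longleftrightarrow> \<not> consistent F st chk (0, 0)"
        using explored_end explored_finish x(5) by blast
      moreover have "t1 + (t + 8) \<le> search_time p * n"
      proof -
        have "t1 + (t + 8) \<le> (Suc T + 7) * n + 13" using x(6) s1 by (simp add: add_mult_distrib)
        then have "t1 + (t + 8) \<le> (Suc T + 7 + 13) * n" by (rule time_le_mult_n)
        also have "\<dots> \<le> search_time p * n" by (intro mult_le_mono1) (simp add: search_time_def T_def)
        finally show ?thesis .
      qed
      ultimately show "Suc (Suc (Suc (Suc (Suc (Suc (Suc (Suc (t1 + t)))))))) \<le> search_time p * n \<and>
          env s' \<and> flags F s' \<and> same_regs s s' \<and> reg s' 14 = w"
        using x by (simp add: stored_def w_def)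
    qed
  qed
qed

end

text \<open>Chosen to cover each case of one level: stripping and testing, a failed peel and
  testing, or a successful peel and a shift.\<close>

definition solve_time :: "nat \<Rightarrow> nat" where
  "solve_time p = 2 * search_time p + p + 120 + (p * (search_time p + 15) + 2)"

section \<open>Changing the final states\<close>

context complete_dfa
begin

lemma same_regs_trans: "same_regs s s' \<Longrightarrow> same_regs s' s'' \<Longrightarrow> same_regs s s''"
  by (simp add: same_regs_def)

lemma wp_pull_prog:
  assumes s: "env s" "flags F s" and d: "d < b"
  shows "wp (pull_prog p d) (\<lambda>t s'. t \<le> (p + 25) * n + 4 \<and> env s' \<and> same_regs s s' \<and>
    (\<forall>q<n. mem s' (adr 1 q) = of_bool (\<delta> q d \<in> F))) s"
proof -
  define I where "I m s' \<longleftrightarrow> env s' \<and> flags F s' \<and> same_regs s s' \<and> reg s' 12 = m \<and> m \<le> n \<and>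
    (\<forall>q. m \<le> q \<and> q < n \<longrightarrow> mem s' (adr 1 q) = of_bool (\<delta> q d \<in> F))" for m s'
  have "wp (block
        [Sub 12 12 8, Const 20 0, Add 25 12 20, iterate p (\<lambda>_. Add 25 25 25), Add 25 25 2,
         Const 20 d, Add 25 25 20, Load 16 25, Add 20 3 16, Load 19 20, Add 20 4 12, Store 20 19])
      (\<lambda>t s''. t \<le> p + 20 \<and> I m s'') s'" if "I (Suc m) s'" for m s'
  proof -
    have I: "env s'" "flags F s'" "same_regs s s'" "reg s' 12 = Suc m" "m < n"
      "\<And>q. m < q \<Longrightarrow> q < n \<Longrightarrow> mem s' (adr 1 q) = of_bool (\<delta> q d \<in> F)"
      using that by (auto simp: I_def Suc_le_eq)
    have regs: "reg s' 2 = cell 0 0" "reg s' 3 = adr 0 0" "reg s' 4 = adr 1 0" "reg s' 8 = 1"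
      "mem s' (cell m d) = \<delta> m d" using I(1,5) d by (auto simp: env_def)
    have \<delta>: "\<delta> m d < n" "mem s' (adr 0 (\<delta> m d)) = of_bool (\<delta> m d \<in> F)"
      using \<delta>_less I(2,5) d by (auto simp: flags_def)
    show ?thesis
      apply (simp add: wp_simps regs I(4))
      apply (rule wp_mono[OF wp_doubling])
      apply (clarsimp simp: wp_simps regs adr_simps \<delta>(2) simp del: One_nat_def)
      using I(3,5,6) d
      by (auto simp: I_def adr_simps same_regs_def le_less
          intro!: env_cong[OF I(1)] flags_cong[OF I(2)])
  qed
  note loop = wp_for[where I = I and i = 12, OF this]
  show ?thesis unfolding pull_prog_def
    apply (simp add: wp_simps)
    apply (rule wp_mono[OF loop[where m = n]])
      apply (simp add: I_def)
     apply (auto simp: I_def same_regs_def env_n[OF s(1)] add_mult_distrib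
        intro!: env_cong[OF s(1)] flags_cong[OF s(2)])
    done
qed

lemma wp_copy_prog:
  assumes s: "env s" "\<forall>q<n. mem s (adr 1 q) = of_bool (q \<in> G)"
  shows "wp copy_prog (\<lambda>t s'. t \<le> 8 * n + 4 \<and> env s' \<and> same_regs s s' \<and> flags G s') s"
proof -
  define I where "I m s' \<longleftrightarrow> env s' \<and> same_regs s s' \<and> reg s' 12 = m \<and> m \<le> n \<and>
    (\<forall>q<n. mem s' (adr 1 q) = of_bool (q \<in> G)) \<and>
    (\<forall>q. m \<le> q \<and> q < n \<longrightarrow> mem s' (adr 0 q) = of_bool (q \<in> G))" for m s'
  have "wp (block [Sub 12 12 8, Add 20 4 12, Load 19 20, Add 20 3 12, Store 20 19])
      (\<lambda>t s''. t \<le> 6 \<and> I m s'') s'" if "I (Suc m) s'" for m s'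
  proof -
    have I: "env s'" "same_regs s s'" "reg s' 12 = Suc m" "m < n"
      "\<And>q. q < n \<Longrightarrow> mem s' (adr 1 q) = of_bool (q \<in> G)"
      "\<And>q. m < q \<Longrightarrow> q < n \<Longrightarrow> mem s' (adr 0 q) = of_bool (q \<in> G)"
      using that by (auto simp: I_def Suc_le_eq)
    have regs: "reg s' 3 = adr 0 0" "reg s' 4 = adr 1 0" "reg s' 8 = 1"
      using I(1) by (auto simp: env_def)
    show ?thesis
      using I(2-6)
      by (auto simp: I_def wp_simps regs adr_simps same_regs_def le_less simp del: One_nat_def
          intro!: env_cong[OF I(1)])
  qed
  note loop = wp_for[where I = I and i = 12, OF this]
  show ?thesis unfolding copy_prog_def
    apply (simp add: wp_simps)
    apply (rule wp_mono[OF loop[where m = n]])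
      apply (simp add: I_def)
    using s(2)
     apply (auto simp: I_def same_regs_def env_n[OF s(1)] flags_def intro!: env_cong[OF s(1)])
    done
qed

lemma wp_shift_prog:
  assumes "env s" "flags F s" "d < b"
  shows "wp (shift_prog p d) (\<lambda>t s'. t \<le> (p + 41) * n \<and> env s' \<and> same_regs s s' \<and>
    flags {q. q < n \<and> \<delta> q d \<in> F} s') s"
  unfolding shift_prog_def wp_Seq
proof (rule wp_mono[OF wp_pull_prog[OF assms]])
  fix t1 :: nat and s1 :: state
  assume s1: "t1 \<le> (p + 25) * n + 4 \<and> env s1 \<and> same_regs s s1 \<and>
    (\<forall>q<n. mem s1 (adr 1 q) = of_bool (\<delta> q d \<in> F))"
  let ?G = "{q. q < n \<and> \<delta> q d \<in> F}"
  have "\<forall>q<n. mem s1 (adr 1 q) = of_bool (q \<in> ?G)" using s1 by simp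
  with s1 have "wp copy_prog (\<lambda>t s'. t \<le> 8 * n + 4 \<and> env s' \<and> same_regs s1 s' \<and> flags ?G s') s1"
    by (intro wp_copy_prog) auto
  then show "wp copy_prog (\<lambda>t2 s'. t1 + t2 \<le> (p + 41) * n \<and> env s' \<and> same_regs s s' \<and>
      flags ?G s') s1"
  proof (rule wp_mono)
    fix t2 :: nat and s2 :: state
    assume s2: "t2 \<le> 8 * n + 4 \<and> env s2 \<and> same_regs s1 s2 \<and> flags ?G s2"
    have "t1 + t2 \<le> (p + 33) * n + 8" using s1 s2 by (simp add: add_mult_distrib)
    then have "t1 + t2 \<le> (p + 33 + 8) * n" by (rule time_le_mult_n)
    then show "t1 + t2 \<le> (p + 41) * n \<and> env s2 \<and> same_regs s s2 \<and> flags ?G s2"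
      using s1 s2 same_regs_trans by (simp add: add.assoc) blast
  qed
qed

lemma wp_search_consistent:
  assumes "edge_correct p (reg s 10) E st chk" "env s" "flags F s"
  shows "wp (search p E) (\<lambda>t s'. t \<le> search_time p * n \<and> env s' \<and> flags F s' \<and> same_regs s s' \<and>
    reg s' 14 = of_bool (\<not> consistent F st chk (0, 0))) s"
  by (rule dfa_search.wp_search[OF dfa_search.intro[OF complete_dfa_axioms] assms(1)])
    (use assms in auto)

lemma wp_peel:
  assumes "env s" "flags F s" "accepts F Y"
  shows "wp (search p (peel_edge d)) (\<lambda>t s'. t \<le> search_time p * n \<and> env s' \<and> flags F s' \<and>
    same_regs s s' \<and> reg s' 14 = of_bool (\<not> (\<forall>v\<in>Y. v mod b = d))) s"
  using wp_search_consistent[OF peel_edge_correct assms(1,2), of d]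
  by (simp only: consistent_peel_iff[OF assms(3)])

section \<open>Trying all moduli\<close>

definition residue_consistent :: "nat set \<Rightarrow> nat \<Rightarrow> nat \<Rightarrow> nat \<Rightarrow> bool" where
  "residue_consistent F r z k \<longleftrightarrow>
    consistent F (residue_step k z) (residue_check k z r) (0, 0)"

text \<open>At most \<open>n\<close> moduli are tried with one linear search each, hence quadratic
  time.\<close>

lemma wp_test_pow:
  assumes s: "env s" "flags F s" "reg s 0 = of_bool A" and z: "z \<le> p"
  shows "wp (test_pow p r z) (\<lambda>t s'. t \<le> (search_time p + 15) * (n * n) \<and> env s' \<and> flags F s' \<and>
    reg s' 0 = of_bool (A \<or> (\<exists>k. r div 2 ^ z < k \<and> k \<le> n \<and> residue_consistent F r z k))) s"
proof -
  define c where "c = r div 2 ^ z"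
  let ?R = "residue_consistent F r z"
  \<comment> \<open>Moduli above \<open>c + m\<close> are already tested; the one tested at counter
    \<open>Suc m\<close> is \<open>Suc (m + c)\<close>.\<close>
  define I where "I m s' \<longleftrightarrow> env s' \<and> flags F s' \<and> reg s' 11 = m \<and> m \<le> n - c \<and>
    reg s' 0 = of_bool (A \<or> (\<exists>k. c + m < k \<and> k \<le> n \<and> ?R k))" for m s'
  have "wp (block
        [Const 20 (r div 2 ^ z), Add 10 11 20, search p (residue_edge p z r),
         If_nz 14 Skip (Const 0 1), Sub 11 11 8])
      (\<lambda>t s''. t \<le> search_time p * n + 8 \<and> I m s'') s'" if "I (Suc m) s'" for m s'
  proof -
    have I: "env s'" "flags F s'" "reg s' 11 = Suc m" "Suc m \<le> n - c"
      "reg s' 0 = of_bool (A \<or> (\<exists>k. c + Suc m < k \<and> k \<le> n \<and> ?R k))"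
      using that by (auto simp: I_def)
    define s1 where "s1 = s'\<lparr>reg := (reg s')(20 := c, 10 := Suc (m + c))\<rparr>"
    have s1: "env s1" "flags F s1" "reg s1 10 = Suc (m + c)"
      unfolding s1_def by (auto intro!: env_cong[OF I(1)] flags_cong[OF I(2)])
    have *: "wp (search p (residue_edge p z r)) (\<lambda>t s'. t \<le> search_time p * n \<and> env s' \<and> flags F s' \<and>
        same_regs s1 s' \<and> reg s' 14 = of_bool (\<not> ?R (Suc (m + c)))) s1"
      unfolding residue_consistent_def
      using wp_search_consistent[OF residue_edge_correct[OF z] s1(1,2)] by (simp only: s1(3))
    have ex: "(\<exists>k. c + m < k \<and> k \<le> n \<and> ?R k) \<longleftrightarrow>
        ?R (Suc (m + c)) \<or> (\<exists>k. c + Suc m < k \<and> k \<le> n \<and> ?R k)"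
    proof -
      have "Suc (m + c) \<le> n" using I(4) by arith
      then have "{k. c + m < k \<and> k \<le> n} = insert (Suc (m + c)) {k. c + Suc m < k \<and> k \<le> n}"
        by auto
      then have "(\<exists>k\<in>{k. c + m < k \<and> k \<le> n}. ?R k) \<longleftrightarrow>
          ?R (Suc (m + c)) \<or> (\<exists>k\<in>{k. c + Suc m < k \<and> k \<le> n}. ?R k)"
        by (simp only: bex_simps)
      then show ?thesis by (simp only: Bex_def mem_Collect_eq conj_assoc)
    qed
    have rest: "wp (block [If_nz 14 Skip (Const 0 1), Sub 11 11 8])
        (\<lambda>t' s'. t' \<le> 5 \<and> I m s') s2"
      if s2: "t \<le> search_time p * n \<and> env s2 \<and> flags F s2 \<and> same_regs s1 s2 \<and>
        reg s2 14 = of_bool (\<not> ?R (Suc (m + c)))" for t s2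
    proof -
      have regs: "reg s2 8 = 1" "reg s2 11 = Suc m" "reg s2 0 = reg s' 0"
        using s2 by (auto simp: env_def s1_def I(3) same_regs_def)
      have e: "env s2" "flags F s2" using s2 by auto
      show ?thesis
        using s2 I(4) unfolding I_def ex
        by (auto simp: wp_simps regs I(5) intro!: env_cong[OF e(1)] flags_cong[OF e(2)])
    qed
    show ?thesis
      unfolding wp_block(2)[of "Const _ _"] wp_block(2)[of "Add _ _ _"] wp_block(2)[of "search _ _"]
        wp_basic
      apply (simp add: I(3) flip: c_def s1_def del: One_nat_def)
      apply (rule wp_mono[OF *])
      apply (rule wp_mono[OF rest], assumption)
      by linarith
  qed
  note loop = wp_for[where I = I and i = 11, OF this]
  have time: "Suc (Suc (Suc t)) \<le> (search_time p + 15) * (n * n)"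
    if "t \<le> Suc (search_time p * n + 8) * (n - c) + 1" for t
  proof -
    have "t \<le> Suc (search_time p * n + 8) * n + 1"
      using that mult_le_mono2[of "n - c" n "Suc (search_time p * n + 8)"] by linarith
    then have "t + 3 \<le> (search_time p * n + 9) * n + 4" by (simp add: add.commute)
    then have "t + 3 \<le> (search_time p * n + 9 + 4) * n" by (rule time_le_mult_n)
    also have "\<dots> \<le> ((search_time p + 13) * n) * n"
      by (intro mult_le_mono1 time_le_mult_n[of _ "search_time p" 13]) simp
    also have "\<dots> \<le> (search_time p + 15) * (n * n)" by (simp add: mult.assoc)
    finally show ?thesis by arith
  qed
  have start: "I (n - c) (s\<lparr>reg := (reg s)(20 := c, 11 := n - c)\<rparr>)"
    using s(3) by (auto simp: I_def intro!: env_cong[OF s(1)] flags_cong[OF s(2)])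
  define w :: nat where
    "w = of_bool (A \<or> (\<exists>k. c < k \<and> k \<le> n \<and> residue_consistent F r z k))"
  show ?thesis unfolding test_pow_def c_def[symmetric] w_def[symmetric]
    apply (simp add: wp_simps env_n[OF s(1), unfolded One_nat_def[symmetric]] del: One_nat_def)
    apply (rule wp_mono[OF loop[folded c_def, where m = "n - c"]])
       apply assumption
      apply (simp add: I_def)
     apply (rule start)
    using time by (auto simp: I_def c_def w_def)
qed


lemma wp_test_prog:
  assumes "env s" "flags F s"
  shows "wp (test_prog p r) (\<lambda>t s'. t \<le> (p * (search_time p + 15) + 2) * (n * n) \<and>
    reg s' 0 = of_bool (\<exists>z<p. \<exists>k. r div 2 ^ z < k \<and> k \<le> n \<and> residue_consistent F r z k)) s"
proof -
  define R where "R z \<longleftrightarrow> (\<exists>k. r div 2 ^ z < k \<and> k \<le> n \<and> residue_consistent F r z k)" for z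
  define I where "I z s' \<longleftrightarrow> env s' \<and> flags F s' \<and> reg s' 0 = of_bool (\<exists>z'<z. R z')" for z s'
  have step: "wp (test_pow p r z) (\<lambda>t s''. t \<le> (search_time p + 15) * (n * n) \<and> I (Suc z) s'') s'"
    if "z < p" "I z s'" for z s'
  proof -
    have I: "env s'" "flags F s'" "reg s' 0 = of_bool (\<exists>z'<z. R z')" using that by (auto simp: I_def)
    have e: "(\<exists>z'<Suc z. R z') \<longleftrightarrow> (\<exists>z'<z. R z') \<or> R z" by (auto simp: less_Suc_eq)
    show ?thesis unfolding I_def e
      by (rule wp_mono[OF wp_test_pow[OF I less_imp_le[OF that(1)], where r = r, folded R_def]]) blast
  qed
  have "1 * 1 \<le> n * n" using n_pos by (intro mult_le_mono) auto
  moreover have "(search_time p + 15) * (n * n) * p + 2 \<le> (p * (search_time p + 15) + 2) * (n * n)"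
    if "1 \<le> n * n"
    using that by (simp add: algebra_simps)
  ultimately have time: "t + 1 \<le> (p * (search_time p + 15) + 2) * (n * n)"
    if "t \<le> (search_time p + 15) * (n * n) * p + 1" for t
    using that by linarith
  show ?thesis unfolding test_prog_def wp_Seq wp_basic
    apply (rule wp_mono[OF wp_iterate[where I = I, OF step]], assumption, assumption)
    using assms time
    by (auto simp: I_def R_def intro!: env_cong[OF assms(1)] flags_cong[OF assms(2)])
qed

section \<open>Removing zeros, and recursion on the remainder\<close>

lemma wp_strip_prog:
  assumes s: "env s" "flags F s" and acc: "accepts F Y"
  shows "wp (strip_prog p) (\<lambda>t s'. t \<le> (search_time p + p + 60) * (n * n) \<and> env s' \<and>
    (\<exists>F' Y'. flags F' s' \<and> accepts F' Y' \<and> (thue_morse_shift Y' 0 \<longleftrightarrow> thue_morse_shift Y 0) \<and>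
      (\<forall>m. 0 < m \<longrightarrow> Y' = mult_trans m 0 thue_morse \<longrightarrow> \<not> b dvd m))) s"
proof -
  define peel where "peel Z \<longleftrightarrow> (\<forall>v\<in>Z. v mod b = 0)" for Z
  \<comment> \<open>\<open>hist i\<close> expresses that each of the \<open>n - i\<close> rounds so
    far has removed a zero. It is claimed only while the current set can be peeled: after a failed
    round the set stays unpeelable and the implication is vacuous.\<close>
  define hist where "hist i Y' \<longleftrightarrow>
    (\<forall>m. Y' = mult_trans m 0 thue_morse \<longrightarrow> Y = mult_trans (b ^ (n - i) * m) 0 thue_morse)" for i Y'
  define I where "I i s' \<longleftrightarrow> env s' \<and> reg s' 11 = i \<and> i \<le> n \<and>
    (\<exists>F' Y'. flags F' s' \<and> accepts F' Y' \<and> (thue_morse_shift Y' 0 \<longleftrightarrow> thue_morse_shift Y 0) \<and>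
      (peel Y' \<longrightarrow> hist i Y'))" for i s'
  have step: "wp (block [search p (peel_edge 0), If_nz 14 Skip (shift_prog p 0), Sub 11 11 8])
      (\<lambda>t s''. t \<le> (search_time p + p + 41) * n + 4 \<and> I i s'') s'" if I0: "I (Suc i) s'" for i s'
  proof -
    obtain F' Y' where I: "env s'" "reg s' 11 = Suc i" "Suc i \<le> n" "flags F' s'" "accepts F' Y'"
      and ans: "thue_morse_shift Y' 0 \<longleftrightarrow> thue_morse_shift Y 0"
      and hist: "peel Y' \<longrightarrow> hist (Suc i) Y'"
      using I0 unfolding I_def by blast
    show ?thesis unfolding wp_block(2)[of "search _ _"]
    proof (rule wp_mono[OF wp_peel[OF I(1,4,5)]])
      fix t1 :: nat and s1 :: state
      assume "t1 \<le> search_time p * n \<and> env s1 \<and> flags F' s1 \<and> same_regs s' s1 \<and>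
        reg s1 14 = of_bool (\<not> (\<forall>v\<in>Y'. v mod b = 0))"
      then have s1: "t1 \<le> search_time p * n" "env s1" "flags F' s1" "same_regs s' s1"
        "reg s1 14 = of_bool (\<not> peel Y')" by (auto simp: peel_def)
      then have r1: "reg s1 11 = Suc i" "reg s1 8 = 1" using I(2) by (auto simp: same_regs_def env_def)
      show "wp (block [If_nz 14 Skip (shift_prog p 0), Sub 11 11 8])
          (\<lambda>t s''. t1 + t \<le> (search_time p + p + 41) * n + 4 \<and> I i s'') s1"
      proof (cases "peel Y'")
        case False
        have "I i (s1\<lparr>reg := (reg s1)(11 := i)\<rparr>)"
          unfolding I_def
          using I False ans
          by (intro conjI exI[of _ F'] exI[of _ Y'])
            (auto intro!: env_cong[OF s1(2)] flags_cong[OF s1(3)])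
        then show ?thesis using False s1(1) by (simp add: wp_simps s1(5) r1 add_mult_distrib)
      next
        case True
        let ?F = "{q. q < n \<and> \<delta> q 0 \<in> F'}" and ?Y = "{v. b * v + 0 \<in> Y'}"
        have acc': "accepts ?F ?Y" by (rule accepts_shift[OF I(5)]) simp
        have "thue_morse_shift ?Y 0 \<longleftrightarrow> thue_morse_shift Y' 0"
          using thue_morse_shift_div_iff[of Y' p 0] True by (simp add: peel_def)
        moreover have "hist i ?Y"
          unfolding hist_def
        proof (intro allI impI)
          fix m assume that: "?Y = mult_trans m 0 thue_morse"
          have "Y' = mult_trans (b * m) 0 thue_morse"
            using mult_trans_of_div[of Y' b 0 m] that True by (simp add: peel_def)
          then have "Y = mult_trans (b ^ (n - Suc i) * (b * m)) 0 thue_morse" using hist True unfolding hist_def by blast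
          moreover have "n - i = Suc (n - Suc i)" using I(3) by simp
          ultimately show "Y = mult_trans (b ^ (n - i) * m) 0 thue_morse"
            by (simp only: power_Suc mult_ac)
        qed
        ultimately have I': "I i s3" if "env s3" "reg s3 11 = i" "flags ?F s3" for s3
          unfolding I_def using that acc' ans I(3)
          by (intro conjI exI[of _ ?F] exI[of _ ?Y]) auto
        show ?thesis
          using True apply (simp add: wp_simps s1(5))
          apply (rule wp_mono[OF wp_shift_prog[OF s1(2,3)]], simp)
          subgoal premises prems for t s2
          proof -
            have e: "env s2" "flags ?F s2" and t: "t \<le> (p + 41) * n" using prems by auto
            have "reg s2 11 = Suc i" "reg s2 8 = 1" using prems r1 by (auto simp: same_regs_def)
            then show ?thesis using s1(1) t
              by (auto simp: wp_simps add_mult_distrib intro!: I' env_cong[OF e(1)] flags_cong[OF e(2)])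
          qed
          done
      qed
    qed
  qed
  note loop = wp_for[where I = I and i = 11, OF step]
  have time: "Suc (Suc (Suc t)) \<le> (search_time p + p + 60) * (n * n)"
    if "t \<le> Suc ((search_time p + p + 41) * n + 4) * n + 1" for t
  proof -
    have "t + 3 \<le> ((search_time p + p + 41) * n + 5) * n + 4" using that by (simp add: add.commute)
    then have "t + 3 \<le> ((search_time p + p + 41) * n + 5 + 4) * n" by (rule time_le_mult_n)
    also have "\<dots> \<le> ((search_time p + p + 41 + 9) * n) * n"
      by (intro mult_le_mono1 time_le_mult_n) simp
    also have "\<dots> \<le> (search_time p + p + 60) * (n * n)"
      unfolding mult.assoc by (intro mult_le_mono1) simp
    finally show ?thesis by arith
  qed
  have start: "I n (s\<lparr>reg := (reg s)(20 := 0, 11 := n)\<rparr>)"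
    unfolding I_def hist_def using acc
    by (intro conjI exI[of _ F] exI[of _ Y])
      (auto intro!: env_cong[OF s(1)] flags_cong[OF s(2)])
  \<comment> \<open>If \<open>b\<close> still divided \<open>m\<close>, the set would be peelable
    after all \<open>n\<close> rounds, and \<open>hist\<close> would give \<open>Y\<close> the
    multiplier \<open>b ^ n * m\<close>, against \<open>power_not_accepted\<close>.\<close>
  have stuck: "\<not> b dvd m" if Y': "peel Y' \<longrightarrow> hist 0 Y'" "0 < m" "Y' = mult_trans m 0 thue_morse" for m Y'
  proof
    assume "b dvd m"
    then have "peel Y'" unfolding peel_def Y'(3) by (auto simp: mult_trans_def mod_eq_0_iff_dvd)
    then have "Y = mult_trans (b ^ n * m) 0 thue_morse" using Y' unfolding hist_def by simp
    then show False using power_not_accepted[of m F] acc Y'(2) by simp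
  qed
  show ?thesis unfolding strip_prog_def
    apply (simp add: wp_simps env_n[OF s(1), unfolded One_nat_def[symmetric]] del: One_nat_def)
    apply (rule wp_mono[OF loop[where m = n]], assumption)
      apply (simp add: I_def)
     apply (rule start)
    subgoal for t s'
      using time[of t] stuck unfolding I_def
      by simp blast
    done
qed


text \<open>Strong induction on \<open>r\<close> follows the unfolding of the program. The factor
  \<open>r + 1\<close> bounds the number of levels; it is a constant because \<open>r\<close> is
  fixed.\<close>

lemma wp_solve_prog:
  assumes "env s" "flags F s" "accepts F Y"
  shows "wp (solve_prog p r) (\<lambda>t s'. t \<le> (r + 1) * solve_time p * (n * n) \<and>
    reg s' 0 = of_bool (thue_morse_shift Y r)) s"
  using assms
proof (induction r arbitrary: s F Y rule: less_induct)
  case (less r)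
  have nn: "n \<le> n * n" using n_pos by simp
  define S where "S = search_time p"
  define T where "T = p * (S + 15) + 2"
  have test: "wp (test_prog p q) (\<lambda>t s'. t \<le> T * (n * n) \<and>
      reg s' 0 = of_bool (thue_morse_shift Y' q)) s'"
    if "env s'" "flags F' s'" "accepts F' Y'"
      "\<And>m. q < m \<Longrightarrow> Y' = mult_trans m q thue_morse \<Longrightarrow> \<not> b dvd m" for q s' F' Y'
    using wp_test_prog[OF that(1,2), of q] thue_morse_shift_iff_consistent[OF that(3,4)]
    by (simp only: residue_consistent_def T_def S_def)
  have C: "solve_time p = S + S + p + 120 + T" by (simp add: solve_time_def T_def S_def)
  have S_le: "S * n \<le> S * (n * n)" "(p + 41) * n \<le> (p + 41) * (n * n)" using nn by simp_all
  show ?case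
  proof (cases "r = 0")
    case True
    have code: "solve_prog p 0 = Seq (strip_prog p) (test_prog p 0)"
      by (simp add: solve_prog.simps[of p 0])
    show ?thesis unfolding True code wp_Seq
      apply (rule wp_mono[OF wp_strip_prog[OF less.prems]])
      apply (elim conjE exE)
      subgoal premises prems for t s' F' Y'
        apply (rule wp_mono[OF test[of s' F' Y' 0]])
        using prems by (auto simp: C S_def add_mult_distrib)
      done
  next
    case False
    have code: "solve_prog p r = Seq (search p (peel_edge (r mod 2 ^ p)))
        (If_nz 14 (test_prog p r)
          (Seq (shift_prog p (r mod 2 ^ p)) (solve_prog p (r div 2 ^ p))))"
      using False p_pos by (simp add: solve_prog.simps[of p r])
    have rec: "r div b < r" using False b_ge_2 by simp
    show ?thesis unfolding code wp_Seq wp_If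
    proof (rule wp_mono[OF wp_peel[OF less.prems]])
      fix t1 :: nat and s1 :: state
      assume "t1 \<le> search_time p * n \<and> env s1 \<and> flags F s1 \<and> same_regs s s1 \<and>
        reg s1 14 = of_bool (\<not> (\<forall>v\<in>Y. v mod b = r mod b))"
      then have s1: "t1 \<le> S * n" "env s1" "flags F s1"
        "reg s1 14 = of_bool (\<not> (\<forall>v\<in>Y. v mod b = r mod b))" by (auto simp: S_def)
      let ?Q = "\<lambda>t s'. t1 + Suc t \<le> (r + 1) * solve_time p * (n * n) \<and>
        reg s' 0 = of_bool (thue_morse_shift Y r)"
      show "if reg s1 14 \<noteq> 0 then wp (test_prog p r) ?Q s1
        else wp (shift_prog p (r mod b)) (\<lambda>t. wp (solve_prog p (r div b))
          (\<lambda>t' s'. ?Q (t + t') s')) s1"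
      proof (cases "\<forall>v\<in>Y. v mod b = r mod b")
        case False
        \<comment> \<open>If \<open>b\<close> divided \<open>m\<close>, every member would end in
          the digit \<open>r mod b\<close>, which the failed peel excludes.\<close>
        have stuck: "\<not> b dvd m" if "r < m" "Y = mult_trans m r thue_morse" for m
        proof
          assume "b dvd m"
          then have "v mod b = r mod b" if "v \<in> mult_trans m r thue_morse" for v
            using that by (auto simp: mult_trans_def mult.assoc elim!: dvdE)
          then show False using False that(2) by blast
        qed
        have "wp (test_prog p r) ?Q s1"
        proof (rule wp_mono[OF test[OF s1(2,3) less.prems(3) stuck]], assumption, assumption)
          fix t s'
          assume t: "t \<le> T * (n * n) \<and> reg s' 0 = of_bool (thue_morse_shift Y r)"
          have "1 * solve_time p * (n * n) \<le> (r + 1) * solve_time p * (n * n)"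
            by (intro mult_le_mono1) simp
          moreover have "t1 + Suc t \<le> solve_time p * (n * n)"
            using t s1(1) S_le nn n_pos unfolding C add_mult_distrib by linarith
          ultimately have "t1 + Suc t \<le> (r + 1) * solve_time p * (n * n)" by linarith
          then show "?Q t s'" using t by blast
        qed
        then show ?thesis using s1(4) False by simp
      next
        case True
        have d: "r mod b < b" by simp
        note ans = thue_morse_shift_div_iff[OF True]
        have "wp (shift_prog p (r mod b)) (\<lambda>t. wp (solve_prog p (r div b))
          (\<lambda>t' s'. ?Q (t + t') s')) s1"
        proof (rule wp_mono[OF wp_shift_prog[OF s1(2,3) d]])
          fix t2 :: nat and s2 :: state
          assume s2: "t2 \<le> (p + 41) * n \<and> env s2 \<and> same_regs s1 s2 \<and>
            flags {q. q < n \<and> \<delta> q (r mod b) \<in> F} s2"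
          show "wp (solve_prog p (r div b)) (\<lambda>t' s'. ?Q (t2 + t') s') s2"
          proof (rule wp_mono[OF less.IH[OF rec _ _ accepts_shift[OF less.prems(3) d]]])
            show "env s2" "flags {q. q < n \<and> \<delta> q (r mod b) \<in> F} s2" using s2 by auto
            fix t3 s3
            assume t3: "t3 \<le> (r div b + 1) * solve_time p * (n * n) \<and>
              reg s3 0 = of_bool (thue_morse_shift {v. b * v + r mod b \<in> Y} (r div b))"
            have "t1 + t2 + 1 \<le> solve_time p * (n * n)"
              using s2 s1(1) S_le nn n_pos unfolding C add_mult_distrib by linarith
            then have "t1 + Suc (t2 + t3) \<le> (Suc (r div b) + 1) * solve_time p * (n * n)"
              using t3 by (simp add: add_mult_distrib)
            \<comment> \<open>\<open>r div b < r\<close> pays for the current level.\<close>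
            also have "\<dots> \<le> (r + 1) * solve_time p * (n * n)"
              using rec by (intro mult_le_mono1 add_le_mono1) simp
            finally show "?Q (t2 + t3) s3" using t3 ans by simp
          qed
        qed
        then show ?thesis using s1(4) True by simp
      qed
    qed
  qed
qed

end

section \<open>From the input to a complete automaton\<close>

definition sink_delta :: "dfa \<Rightarrow> nat \<Rightarrow> nat \<Rightarrow> nat" where
  "sink_delta A q a =
     (if q < num_states A then case delta A q a of None \<Rightarrow> num_states A | Some q' \<Rightarrow> q'
      else num_states A)"

lemma complete_dfa_sink:
  assumes "wf_dfa (2 ^ p) A" "p \<ge> 1"
  shows "complete_dfa p (Suc (num_states A)) (initial A) (sink_delta A)"
  using assms by unfold_locales
    (auto simp: wf_dfa_def sink_delta_def less_Suc_eq split: option.split)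

lemma foldl_sink: "foldl (sink_delta A) (num_states A) u = num_states A"
  by (induction u) (auto simp: sink_delta_def)

lemma run_iff_foldl_sink:
  assumes "wf_dfa b A" "u \<in> lists {..<b}" "q < num_states A" "q' < num_states A"
  shows "run A q u = Some q' \<longleftrightarrow> foldl (sink_delta A) q u = q'"
  using assms(2,3)
proof (induction u arbitrary: q)
  case (Cons a u)
  show ?case
  proof (cases "delta A q a")
    case None
    then have "sink_delta A q a = num_states A" by (simp add: sink_delta_def)
    then show ?thesis using None assms(4) by (simp add: foldl_sink)
  next
    case (Some q1)
    moreover have "a < b" using Cons.hyps by simp
    ultimately have "q1 < num_states A" using assms(1) Cons.prems unfolding wf_dfa_def by blast
    then show ?thesis using Cons Some by (simp add: sink_delta_def)
  qed
qed simp

text \<open>Final states lie below \<open>num_states A\<close>, so the sink rejects and completion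
  preserves the language.\<close>

lemma recognizes_accepts:
  assumes "recognizes (2 ^ p) A Y" "p \<ge> 1"
  shows "complete_dfa.accepts p (initial A) (sink_delta A) (final A) Y"
proof -
  have wf: "wf_dfa (2 ^ p) A" and L: "language (2 ^ p) A = rep_lang (2 ^ p) Y"
    using assms by (auto simp: recognizes_def)
  interpret complete_dfa p "Suc (num_states A)" "initial A" "sink_delta A"
    by (rule complete_dfa_sink[OF wf assms(2)])
  have q: "initial A < num_states A" "\<And>q. q \<in> final A \<Longrightarrow> q < num_states A"
    using wf by (auto simp: wf_dfa_def)
  show ?thesis unfolding accepts_def
  proof
    fix u assume u: "u \<in> words"
    have "reach u \<in> final A \<longleftrightarrow> (\<exists>q\<in>final A. run A (initial A) u = Some q)"
      using run_iff_foldl_sink[OF wf u q(1)] q(2) by auto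
    also have "\<dots> \<longleftrightarrow> u \<in> language b A" using u by (simp add: language_def)
    also have "\<dots> \<longleftrightarrow> val b u \<in> Y" using u by (simp add: L rep_lang_def)
    finally show "reach u \<in> final A \<longleftrightarrow> val b u \<in> Y" .
  qed
qed

lemma nth_concat_map_map:
  assumes "i < m" "a < b"
  shows "concat (map (\<lambda>q. map (f q) [0..<b]) [0..<m]) ! (i * b + a) = f i a"
  using assms(1)
proof (induction m)
  case (Suc m)
  have len: "length (concat (map (\<lambda>q. map (f q) [0..<b]) [0..<m])) = m * b"
    by (induction m) auto
  show ?case
  proof (cases "i < m")
    case True
    then have "i * b + a < m * b"
      using mult_le_mono1[of "Suc i" m b] assms(2) by simp
    then show ?thesis using Suc.IH[OF True] by (simp add: nth_append len)
  next
    case False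
    then have "i = m" using Suc.prems by simp
    then show ?thesis using assms(2) by (simp add: nth_append len)
  qed
qed simp

lemma load_encode_dfa:
  fixes A b
  defines "s \<equiv> load_input (encode_dfa b A)"
  shows "mem s 0 = num_states A" "mem s 1 = initial A"
    "q < num_states A \<Longrightarrow> mem s (2 + q) = of_bool (q \<in> final A)"
    "q < num_states A \<Longrightarrow> a < b \<Longrightarrow> mem s (2 + num_states A + q * b + a) =
      (case delta A q a of None \<Rightarrow> num_states A | Some q' \<Rightarrow> q')"
    "i \<ge> 2 + num_states A + num_states A * b \<Longrightarrow> mem s i = 0"
    "reg s i = 0"
proof -
  let ?N = "num_states A"
  let ?f = "\<lambda>q a. case delta A q a of None \<Rightarrow> ?N | Some q' \<Rightarrow> q'"
  let ?rows = "concat (map (\<lambda>q. map (?f q) [0..<b]) [0..<?N])"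
  have len: "length ?rows = ?N * b" by (induction "?N") (auto simp: length_concat sum_list_triv comp_def)
  have enc: "encode_dfa b A = [?N, initial A] @ map (\<lambda>q. if q \<in> final A then 1 else 0) [0..<?N] @ ?rows"
    by (simp add: encode_dfa_def)
  have total: "length (encode_dfa b A) = 2 + ?N + ?N * b" unfolding enc by (simp add: len)
  show "mem s 0 = ?N" "mem s 1 = initial A" "reg s i = 0"
    by (simp_all add: s_def load_input_def enc)
  show "mem s (2 + q) = of_bool (q \<in> final A)" if "q < ?N"
    using that by (simp add: s_def load_input_def total) (simp add: enc nth_append)
  show "mem s i = 0" if "i \<ge> 2 + ?N + ?N * b"
    using that by (simp add: s_def load_input_def total)
  show "mem s (2 + ?N + q * b + a) = ?f q a" if "q < ?N" "a < b"
  proof -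
    have "q * b + a < ?N * b" using mult_le_mono1[of "Suc q" ?N b] that by simp
    then show ?thesis
      using nth_concat_map_map[OF that, of ?f]
      by (simp add: s_def load_input_def total) (simp add: enc nth_append)
  qed
qed

lemma (in complete_dfa) cell_eq_iff:
  "a < b \<Longrightarrow> a' < b \<Longrightarrow> cell q a = cell q' a' \<longleftrightarrow> q = q' \<and> a = a'"
proof -
  assume a: "a < b" "a' < b"
  have "q = q'" if "q * b + a = q' * b + a'"
  proof -
    have "(a + q * b) div b = (a' + q' * b) div b" using that by (simp add: add.commute)
    then show ?thesis using a by simp
  qed
  then show ?thesis by (auto simp: cell_def)
qed

lemma wp_setup_prog:
  assumes wf: "wf_dfa (2 ^ p) A" and p: "p \<ge> 1"
  shows "wp (setup_prog p)
    (\<lambda>t s'. t \<le> 8 * num_states A + (6 * 2 ^ p + p + 30) \<and>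
      complete_dfa.env p (Suc (num_states A)) (initial A) (sink_delta A) s' \<and>
      complete_dfa.flags p (Suc (num_states A)) (final A) s')
    (load_input (encode_dfa (2 ^ p) A))"
proof -
  define N where "N = num_states A"
  define s where "s = load_input (encode_dfa (2 ^ p) A)"
  interpret complete_dfa p "Suc N" "initial A" "sink_delta A"
    unfolding N_def by (rule complete_dfa_sink[OF wf p])
  note load = load_encode_dfa[where A = A and b = b, folded s_def N_def]
  have fin: "q < N" if "q \<in> final A" for q using wf that by (auto simp: wf_dfa_def N_def)
  have low: "2 + q \<noteq> cell q' a" "2 + q \<noteq> adr j x" if "q < N" for q q' a j x
    using that by (simp_all add: cell_def adr_def)
  define regs where "regs s' \<longleftrightarrow> reg s' 1 = Suc N \<and> reg s' 2 = cell 0 0 \<and> reg s' 3 = adr 0 0 \<and>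
    reg s' 4 = adr 1 0 \<and> reg s' 5 = adr 2 0 \<and> reg s' 6 = adr 3 0 \<and> reg s' 7 = adr 4 0 \<and>
    reg s' 8 = 1 \<and> reg s' 9 = initial A \<and> reg s' 10 = N" for s' :: state
  \<comment> \<open>The last \<open>j\<close> cells of the row of the sink are filled; the flags
    array is still zero because it lies beyond the input.\<close>
  define I where "I j s' \<longleftrightarrow> regs s' \<and>
    (\<forall>q<N. \<forall>a<b. mem s' (cell q a) = sink_delta A q a) \<and>
    (\<forall>a<b. b \<le> a + j \<longrightarrow> mem s' (cell N a) = N) \<and>
    (\<forall>q<N. mem s' (2 + q) = of_bool (q \<in> final A)) \<and>
    (\<forall>q<Suc N. mem s' (adr 0 q) = 0)" for j and s' :: state
  have row: "wp (block [Const 20 (Suc j), Sub 20 3 20, Store 20 10])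
      (\<lambda>t s''. t \<le> 4 \<and> I (Suc j) s'') s'" if "j < b" "I j s'" for j s'
  proof -
    have I: "regs s'" "\<forall>q<N. \<forall>a<b. mem s' (cell q a) = sink_delta A q a"
      "\<forall>a<b. b \<le> a + j \<longrightarrow> mem s' (cell N a) = N"
      "\<forall>q<N. mem s' (2 + q) = of_bool (q \<in> final A)" "\<forall>q<Suc N. mem s' (adr 0 q) = 0"
      using that(2) by (auto simp: I_def)
    have r: "reg s' 3 = adr 0 0" "reg s' 10 = N" using I(1) by (auto simp: regs_def)
    have e: "adr 0 0 - Suc j = cell N (b - Suc j)" using that(1) by (simp add: adr_def cell_def)
    have lt: "b - Suc j < b" using that(1) by simp
    define s2 where "s2 = s'\<lparr>reg := (reg s')(20 := cell N (b - Suc j)),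
      mem := (mem s')(cell N (b - Suc j) := N)\<rparr>"
    have "I (Suc j) s2" unfolding I_def
    proof (intro conjI)
      show "regs s2" using I(1) by (simp add: regs_def s2_def)
      show "\<forall>q<N. \<forall>a<b. mem s2 (cell q a) = sink_delta A q a"
        using I(2) lt by (auto simp: s2_def cell_eq_iff)
      show "\<forall>a<b. b \<le> a + Suc j \<longrightarrow> mem s2 (cell N a) = N"
      proof (intro allI impI)
        fix a assume a: "a < b" "b \<le> a + Suc j"
        then have "a = b - Suc j \<or> b \<le> a + j" by linarith
        then show "mem s2 (cell N a) = N" using I(3) a(1) by (auto simp: s2_def)
      qed
      show "\<forall>q<N. mem s2 (2 + q) = of_bool (q \<in> final A)"
        using I(4) low by (simp add: s2_def)
      show "\<forall>q<Suc N. mem s2 (adr 0 q) = 0"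
      proof (intro allI impI)
        fix q assume "q < Suc N"
        moreover have "adr 0 q \<noteq> cell N (b - Suc j)"
          using cell_neq_adr[of N "b - Suc j" 0 q] lt by simp
        ultimately show "mem s2 (adr 0 q) = 0" using I(5) by (simp add: s2_def)
      qed
    qed
    then show ?thesis by (simp add: wp_simps r e s2_def)
  qed
  define J where "J m s' \<longleftrightarrow> env s' \<and> reg s' 12 = m \<and> m \<le> N \<and>
    (\<forall>q<N. mem s' (2 + q) = of_bool (q \<in> final A)) \<and>
    (\<forall>q<Suc N. m \<le> q \<longrightarrow> mem s' (adr 0 q) = of_bool (q \<in> final A))" for m s'
  have copy: "wp (block [Sub 12 12 8, Const 20 2, Add 20 20 12, Load 19 20, Add 20 3 12, Store 20 19])
      (\<lambda>t s''. t \<le> 7 \<and> J m s'') s'" if "J (Suc m) s'" for m s'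
  proof -
    have J: "env s'" "reg s' 12 = Suc m" "m < N"
      "\<And>q. q < N \<Longrightarrow> mem s' (2 + q) = of_bool (q \<in> final A)"
      "\<And>q. m < q \<Longrightarrow> q < Suc N \<Longrightarrow> mem s' (adr 0 q) = of_bool (q \<in> final A)"
      using that by (auto simp: J_def Suc_le_eq)
    have r: "reg s' 3 = adr 0 0" "reg s' 8 = 1" using J(1) by (auto simp: env_def)
    define s2 where "s2 = s'\<lparr>reg := (reg s')(12 := m, 19 := of_bool (m \<in> final A), 20 := adr 0 m),
      mem := (mem s')(adr 0 m := of_bool (m \<in> final A))\<rparr>"
    have "J m s2" unfolding J_def
    proof (intro conjI)
      show "env s2" using J(3) by (intro env_cong[OF J(1)]) (auto simp: s2_def cell_neq_adr)
      show "reg s2 12 = m" "m \<le> N" using J(3) by (simp_all add: s2_def)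
      show "\<forall>q<N. mem s2 (2 + q) = of_bool (q \<in> final A)"
        using J(4) low by (simp add: s2_def)
      show "\<forall>q<Suc N. m \<le> q \<longrightarrow> mem s2 (adr 0 q) = of_bool (q \<in> final A)"
        using J(3,5) by (auto simp: s2_def adr_simps le_less)
    qed
    moreover have "mem s' (Suc (Suc m)) = of_bool (m \<in> final A)" using J(4)[OF J(3)] by simp
    ultimately show ?thesis using J(2)
      apply (simp add: wp_simps r adr_simps split del: split_of_bool)
      apply (simp add: s2_def fun_upd_twist)
      done
  qed
  have r2: "mem s (Suc 0) = initial A" using load(2) by simp
  have start: "I 0 s'" if "regs s'" "mem s' = mem s" for s'
    unfolding I_def
  proof (intro conjI)
    show "\<forall>q<N. \<forall>a<b. mem s' (cell q a) = sink_delta A q a"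
      using load(4) that by (simp add: cell_def sink_delta_def N_def[symmetric] cong: option.case_cong)
    show "\<forall>q<N. mem s' (2 + q) = of_bool (q \<in> final A)" using load(3) that by simp
    show "\<forall>q<Suc N. mem s' (adr 0 q) = 0" using load(5) that by (simp add: adr_def cell_def)
  qed (use that in auto)
  have mid: "J N s''" if "I b s'" "mem s'' = mem s'" "reg s'' 12 = N"
    "\<And>i. i < 12 \<Longrightarrow> reg s'' i = reg s' i" for s' s''
    unfolding J_def
  proof (intro conjI)
    have "mem s' (cell q a) = sink_delta A q a" if "q < Suc N" "a < b" for q a
      using that \<open>I b s'\<close> by (auto simp: I_def less_Suc_eq sink_delta_def simp flip: N_def)
    then show "env s''" using that unfolding env_def I_def regs_def by simp
    show "\<forall>q<Suc N. N \<le> q \<longrightarrow> mem s'' (adr 0 q) = of_bool (q \<in> final A)"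
    proof (intro allI impI)
      fix q assume q: "q < Suc N" "N \<le> q"
      \<comment> \<open>Here \<open>q\<close> is the sink, whose flag is the untouched 0.\<close>
      then have "q \<notin> final A" using fin[of q] by auto
      then show "mem s'' (adr 0 q) = of_bool (q \<in> final A)"
        using q that(1,2) by (simp add: I_def)
    qed
  qed (use that in \<open>auto simp: I_def\<close>)
  note rows = wp_iterate[where I = I, OF row]
  note loop = wp_for[where I = J and i = 12, OF copy]
  show ?thesis unfolding setup_prog_def s_def[symmetric] N_def[symmetric]
    apply (simp add: wp_simps load r2)
    apply (rule wp_mono[OF wp_doubling])
    apply clarsimp
    apply (rule wp_mono[OF rows], assumption, assumption)
     apply (rule start; simp add: regs_def adr_def cell_def)
    apply clarsimp
    apply (rule wp_mono[OF loop[where m = N]], assumption)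
      apply (simp add: J_def)
     apply (rule mid, assumption; simp add: I_def regs_def)
    by (auto simp: J_def flags_def)
qed

theorem corollary48:
  fixes p r :: nat
  assumes "p \<ge> 1"
  shows "\<exists>(prog :: com) (T :: nat \<Rightarrow> nat).
    (\<lambda>N. real (T N)) \<in> O(\<lambda>N. real N ^ 2) \<and>
    (\<forall>A Y. recognizes (2 ^ p) A Y \<longrightarrow>
      (\<exists>t s. exec prog (load_input (encode_dfa (2 ^ p) A)) t s \<and>
        t \<le> T (num_states A) \<and>
        reg s 0 = (if \<exists>m. m \<ge> 1 \<and> r < m \<and> Y = mult_trans m r thue_morse then 1 else 0)))"
proof -
  \<comment> \<open>The setup contributes its constant, with 8 more to absorb its linear part; the
    solver runs on \<open>Suc N\<close> states, one of them the sink.\<close>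
  define c where "c = 6 * 2 ^ p + p + 38 + (r + 1) * solve_time p"
  define T where "T N = c * (Suc N * Suc N)" for N
  have "(\<lambda>N. real (T N)) \<in> O(\<lambda>N. real N ^ 2)"
  proof (rule bigoI[where c = "4 * real c"])
    show "\<forall>\<^sub>F N in sequentially. norm (real (T N)) \<le> 4 * real c * norm (real N ^ 2)"
      using eventually_ge_at_top[of 1]
    proof eventually_elim
      case (elim N)
      then have "Suc N * Suc N \<le> (2 * N) * (2 * N)" by (intro mult_le_mono) auto
      then have "T N \<le> c * (4 * (N * N))" unfolding T_def by (intro mult_le_mono2) simp
      then have "real (T N) \<le> real (c * (4 * (N * N)))" by (rule of_nat_mono)
      then show ?case by (simp add: power2_eq_square)
    qed
  qed
  \<comment> \<open>The program is built from \<open>p\<close> and \<open>r\<close> alone, so a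
    single one serves all automata.\<close>
  moreover have "\<exists>t s. exec (Seq (setup_prog p) (solve_prog p r)) (load_input (encode_dfa (2 ^ p) A)) t s \<and>
      t \<le> T (num_states A) \<and>
      reg s 0 = (if \<exists>m. m \<ge> 1 \<and> r < m \<and> Y = mult_trans m r thue_morse then 1 else 0)"
    if rec: "recognizes (2 ^ p) A Y" for A Y
  proof -
    have wf: "wf_dfa (2 ^ p) A" using rec by (simp add: recognizes_def)
    interpret complete_dfa p "Suc (num_states A)" "initial A" "sink_delta A"
      by (rule complete_dfa_sink[OF wf assms])
    have acc: "accepts (final A) Y" by (rule recognizes_accepts[OF rec assms])
    have "wp (Seq (setup_prog p) (solve_prog p r))
        (\<lambda>t s. t \<le> T (num_states A) \<and> reg s 0 = of_bool (thue_morse_shift Y r))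
        (load_input (encode_dfa (2 ^ p) A))"
      unfolding wp_Seq
    proof (rule wp_mono[OF wp_setup_prog[OF wf assms]], elim conjE)
      fix t s assume t: "t \<le> 8 * num_states A + (6 * 2 ^ p + p + 30)" and s: "env s" "flags (final A) s"
      show "wp (solve_prog p r) (\<lambda>t' s'. t + t' \<le> T (num_states A) \<and>
          reg s' 0 = of_bool (thue_morse_shift Y r)) s"
      proof (rule wp_mono[OF wp_solve_prog[OF s acc]], elim conjE, intro conjI)
        fix t' assume t': "t' \<le> (r + 1) * solve_time p * (Suc (num_states A) * Suc (num_states A))"
        define n where "n = Suc (num_states A)"
        have n: "num_states A \<le> n * n" "1 \<le> n * n" by (simp_all add: n_def)
        have "(6 * 2 ^ p + p + 30) * 1 \<le> (6 * 2 ^ p + p + 30) * (n * n)"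
          using n(2) by (intro mult_le_mono2)
        then have "t \<le> (6 * 2 ^ p + p + 38) * (n * n)"
          using t n(1) unfolding add_mult_distrib by linarith
        then have "t + t' \<le> c * (n * n)"
          using t' unfolding c_def n_def[symmetric] add_mult_distrib by linarith
        then show "t + t' \<le> T (num_states A)" by (simp add: T_def n_def)
      qed
    qed
    then show ?thesis unfolding wp_def thue_morse_shift_def of_bool_def by blast
  qed
  ultimately show ?thesis by blast
qed

end
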